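(* Let $G$ be a $\mathbf{W}$-object with Madden frame $L$ and Madden representation $g\mapsto\widehat g$, $G\to\mathcal{R}L$. Let $\{g_n\}_{n\in\mathbb{N}}\subseteq G^+$ be the sequence of truncates of some $h\in(\mathcal{R}L)^+$, i.e., $\widehat g_n = h\wedge n$ for all $n$. Then (1) $g_{n+1}\wedge n = g_n$ in $G$ for all $n$, and (2) $\bigvee_n \widehat g_n(-\infty,n)=\top$ in $L$. Conversely, any sequence $\{g_n\}_{n\in\mathbb{N}}$ in $G$ having properties (1) and (2) is the sequence of truncates of some $h\in\mathcal{R}L$, i.e., there is $h\in\mathcal{R}L$ with $\widehat g_n = h\wedge n$ for all $n$.
   Context: $\mathbf{W}$ is the category of archimedean lattice-ordered groups $G$ with a designated weak order unit, written $1$ (so $1\ge 0$ and $g \wedge 1 = 0$ with $g \geq 0$ implies $g = 0$); morphisms are lattice-ordered group homomorphisms carrying designated unit to designated unit. $n$ ranges over the positive integers and also denotes the multiple $n\cdot 1$ of the unit. $G^+=\{g\in G: g\ge 0\}$. A $\mathbf{W}$-kernel of $G$ is the kernel of a $\mathbf{W}$-morphism out of $G$. For $S \subseteq G$, $[S]$ is the smallest $\mathbf{W}$-kernel of $G$ containing $S$. The $\mathbf{W}$-kernels of $G$, ordered by inclusion, form a (regular Lindelöf) frame $L = \mathcal{M}G$, the Madden frame of $G$. $\mathcal{O}\mathbb{R}$ is the frame of open subsets of $\mathbb{R}$, and $\mathcal{R}L$ is the set of frame maps $\mathcal{O}\mathbb{R} \to L$; write $f(r,\infty)$ for $f((r,\infty))$,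 and similarly for $f(-\infty,r)$. $\mathcal{R}L$ is a $\mathbf{W}$-object: a continuous operation $w : \mathbb{R}^n \to \mathbb{R}$ lifts to $\mathcal{R}L$ by $w'(f_1,\dots,f_n)(U) = \bigvee \{ f_1(U_1)\wedge\dots\wedge f_n(U_n) : U_i \in \mathcal{O}\mathbb{R},\ w(U_1\times\dots\times U_n)\subseteq U\}$, a real constant $r$ is the map with $r(U) = \top$ if $r \in U$ and $\bot$ otherwise, the designated unit is the constant $1$, and $f \le g$ iff $f(r,\infty)\le g(r,\infty)$ for all $r \in \mathbb{R}$. The Madden representation $G \to \mathcal{R}L$, $g \mapsto \widehat g$, is the injective $\mathbf{W}$-morphism with $\widehat g(r,\infty) = [(g-r)^+]$. If the constant $r$ is not in $G$ this is read as follows: for rational $r=p/q$, $q>0$, $[(g-r)^+]$ means $[(qg - p\cdot 1)^+]$, and for arbitrary real $r$ it is the join of these over rationals $s>r$. *)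

theory Defs
  imports Complex_Main "HOL-Library.Lattice_Algebras" "HOL-Library.FuncSet"
begin

section \<open>Archimedean lattice-ordered groups with weak order unit\<close>

record 'a w_struct =
  w_carrier :: "'a set"
  w_add :: "'a \<Rightarrow> 'a \<Rightarrow> 'a"
  w_zero :: 'a
  w_neg :: "'a \<Rightarrow> 'a"
  w_meet :: "'a \<Rightarrow> 'a \<Rightarrow> 'a"
  w_join :: "'a \<Rightarrow> 'a \<Rightarrow> 'a"
  w_unit :: 'a

definition w_le :: "'a w_struct \<Rightarrow> 'a \<Rightarrow> 'a \<Rightarrow> bool" where
  "w_le H x y \<longleftrightarrow> w_meet H x y = x"

definition w_nmult :: "'a w_struct \<Rightarrow> nat \<Rightarrow> 'a \<Rightarrow> 'a" where
  "w_nmult H n x = (w_add H x ^^ n) (w_zero H)"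

text \<open>Archimedean lattice-ordered groups are abelian, so commutativity of addition is built in.\<close>

locale w_object =
  fixes H :: "'a w_struct"
  assumes zero_closed: "w_zero H \<in> w_carrier H"
    and unit_closed: "w_unit H \<in> w_carrier H"
    and neg_closed: "x \<in> w_carrier H \<Longrightarrow> w_neg H x \<in> w_carrier H"
    and add_closed: "\<lbrakk>x \<in> w_carrier H; y \<in> w_carrier H\<rbrakk> \<Longrightarrow> w_add H x y \<in> w_carrier H"
    and meet_closed: "\<lbrakk>x \<in> w_carrier H; y \<in> w_carrier H\<rbrakk> \<Longrightarrow> w_meet H x y \<in> w_carrier H"
    and join_closed: "\<lbrakk>x \<in> w_carrier H; y \<in> w_carrier H\<rbrakk> \<Longrightarrow> w_join H x y \<in> w_carrier H"
    and add_assoc: "\<lbrakk>x \<in> w_carrier H; y \<in> w_carrier H; z \<in> w_carrier H\<rbrakk>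
      \<Longrightarrow> w_add H (w_add H x y) z = w_add H x (w_add H y z)"
    and add_comm: "\<lbrakk>x \<in> w_carrier H; y \<in> w_carrier H\<rbrakk> \<Longrightarrow> w_add H x y = w_add H y x"
    and add_zero: "x \<in> w_carrier H \<Longrightarrow> w_add H (w_zero H) x = x"
    and add_neg: "x \<in> w_carrier H \<Longrightarrow> w_add H (w_neg H x) x = w_zero H"
    and meet_assoc: "\<lbrakk>x \<in> w_carrier H; y \<in> w_carrier H; z \<in> w_carrier H\<rbrakk>
      \<Longrightarrow> w_meet H (w_meet H x y) z = w_meet H x (w_meet H y z)"
    and join_assoc: "\<lbrakk>x \<in> w_carrier H; y \<in> w_carrier H; z \<in> w_carrier H\<rbrakk>
      \<Longrightarrow> w_join H (w_join H x y) z = w_join H x (w_join H y z)"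
    and meet_comm: "\<lbrakk>x \<in> w_carrier H; y \<in> w_carrier H\<rbrakk> \<Longrightarrow> w_meet H x y = w_meet H y x"
    and join_comm: "\<lbrakk>x \<in> w_carrier H; y \<in> w_carrier H\<rbrakk> \<Longrightarrow> w_join H x y = w_join H y x"
    and meet_join_absorb: "\<lbrakk>x \<in> w_carrier H; y \<in> w_carrier H\<rbrakk> \<Longrightarrow> w_meet H x (w_join H x y) = x"
    and join_meet_absorb: "\<lbrakk>x \<in> w_carrier H; y \<in> w_carrier H\<rbrakk> \<Longrightarrow> w_join H x (w_meet H x y) = x"
    and add_meet_distrib: "\<lbrakk>x \<in> w_carrier H; y \<in> w_carrier H; z \<in> w_carrier H\<rbrakk>
      \<Longrightarrow> w_add H x (w_meet H y z) = w_meet H (w_add H x y) (w_add H x z)"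
    and add_join_distrib: "\<lbrakk>x \<in> w_carrier H; y \<in> w_carrier H; z \<in> w_carrier H\<rbrakk>
      \<Longrightarrow> w_add H x (w_join H y z) = w_join H (w_add H x y) (w_add H x z)"
    and archimedean: "\<lbrakk>x \<in> w_carrier H; y \<in> w_carrier H; w_le H (w_zero H) x;
      \<And>n. w_le H (w_nmult H n x) y\<rbrakk> \<Longrightarrow> x = w_zero H"
    and unit_nonneg: "w_le H (w_zero H) (w_unit H)"
    and weak_unit: "\<lbrakk>x \<in> w_carrier H; w_le H (w_zero H) x; w_meet H x (w_unit H) = w_zero H\<rbrakk>
      \<Longrightarrow> x = w_zero H"

definition w_morphism :: "'a w_struct \<Rightarrow> 'b w_struct \<Rightarrow> ('a \<Rightarrow> 'b) \<Rightarrow> bool" where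
  "w_morphism G H \<phi> \<longleftrightarrow>
     (\<forall>x\<in>w_carrier G. \<phi> x \<in> w_carrier H) \<and>
     (\<forall>x\<in>w_carrier G. \<forall>y\<in>w_carrier G.
        \<phi> (w_add G x y) = w_add H (\<phi> x) (\<phi> y) \<and>
        \<phi> (w_meet G x y) = w_meet H (\<phi> x) (\<phi> y) \<and>
        \<phi> (w_join G x y) = w_join H (\<phi> x) (\<phi> y)) \<and>
     \<phi> (w_unit G) = w_unit H"

text \<open>From here on the group under consideration is a whole type \<open>'a\<close>, with designated
  unit \<open>e\<close>.\<close>

definition type_w :: "'a::lattice_ab_group_add \<Rightarrow> 'a w_struct" where
  "type_w e = \<lparr>w_carrier = UNIV, w_add = (+), w_zero = 0, w_neg = uminus,
     w_meet = inf, w_join = sup, w_unit = e\<rparr>"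

definition nmult :: "nat \<Rightarrow> 'a \<Rightarrow> 'a::lattice_ab_group_add" where
  "nmult n x = ((+) x ^^ n) 0"

definition imult :: "int \<Rightarrow> 'a \<Rightarrow> 'a::lattice_ab_group_add" where
  "imult k x = (if 0 \<le> k then nmult (nat k) x else - nmult (nat (- k)) x)"


section \<open>Kernels and the Madden frame\<close>

text \<open>The codomain of the morphism is taken on the type \<open>'a set\<close>, where the cosets of a
  kernel live. The lemma below shows that codomains on other types give no further kernels.\<close>

definition w_kernel :: "'a::lattice_ab_group_add \<Rightarrow> 'a set \<Rightarrow> bool" where
  "w_kernel e K \<longleftrightarrow> (\<exists>(H :: 'a set w_struct) \<phi>.
     w_object H \<and> w_morphism (type_w e) H \<phi> \<and> K = {x. \<phi> x = w_zero H})"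

lemma w_kernel_any_codomain:
  fixes e :: "'a::lattice_ab_group_add" and H :: "'b w_struct"
  assumes H: "w_object H" and \<phi>: "w_morphism (type_w e) H \<phi>"
  shows "w_kernel e {x. \<phi> x = w_zero H}"
proof -
  interpret w_object H by (fact H)
  have car [simp]: "\<phi> x \<in> w_carrier H" for x
    using \<phi> by (simp add: w_morphism_def type_w_def)
  have hom: "\<phi> (x + y) = w_add H (\<phi> x) (\<phi> y)" "\<phi> (inf x y) = w_meet H (\<phi> x) (\<phi> y)"
    "\<phi> (sup x y) = w_join H (\<phi> x) (\<phi> y)" "\<phi> e = w_unit H" for x y
    using \<phi> by (simp_all add: w_morphism_def type_w_def)
  have zero: "\<phi> 0 = w_zero H"
  proof -
    have "\<phi> 0 = w_add H (w_add H (w_neg H (\<phi> 0)) (\<phi> 0)) (\<phi> 0)"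
      by (simp add: add_neg add_zero)
    also have "\<dots> = w_add H (w_neg H (\<phi> 0)) (\<phi> (0 + 0))"
      unfolding hom(1) by (simp add: add_assoc neg_closed)
    also have "\<dots> = w_zero H" by (simp add: add_neg)
    finally show ?thesis .
  qed
  have neg: "\<phi> (- x) = \<phi> (- y)" if "\<phi> x = \<phi> y" for x y
  proof -
    have "\<phi> (- x) = \<phi> (- x + (y + - y))" by simp
    also have "\<dots> = \<phi> (- x + (x + - y))" unfolding hom(1) that ..
    finally show ?thesis by simp
  qed
  have mult: "\<phi> (nmult n x) = w_nmult H n (\<phi> x)" for n x
    by (induction n) (simp_all add: nmult_def w_nmult_def zero hom)
  define c where "c x = {y. \<phi> y = \<phi> x}" for x
  define r where "r X = (SOME x. x \<in> X)" for X :: "'a set"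
  have c_eq: "c x = c y \<longleftrightarrow> \<phi> x = \<phi> y" for x y
    unfolding c_def by (metis (mono_tags) mem_Collect_eq)
  have r [simp]: "\<phi> (r (c x)) = \<phi> x" for x
    unfolding r_def c_def by (rule someI2[of _ x]) auto
  define Q where "Q = \<lparr>w_carrier = range c, w_add = (\<lambda>X Y. c (r X + r Y)), w_zero = c 0,
     w_neg = (\<lambda>X. c (- r X)), w_meet = (\<lambda>X Y. c (inf (r X) (r Y))),
     w_join = (\<lambda>X Y. c (sup (r X) (r Y))), w_unit = c e\<rparr>"
  have Q [simp]: "w_carrier Q = range c" "w_zero Q = c 0" "w_unit Q = c e"
    "w_add Q (c x) (c y) = c (x + y)" "w_neg Q (c x) = c (- x)"
    "w_meet Q (c x) (c y) = c (inf x y)" "w_join Q (c x) (c y) = c (sup x y)" for x y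
    by (simp_all add: Q_def c_eq hom neg[OF r])
  have Qmult: "w_nmult Q n (c x) = c (nmult n x)" for n x
    by (induction n) (simp_all add: nmult_def w_nmult_def)
  have Qle: "w_le Q (c x) (c y) \<longleftrightarrow> w_le H (\<phi> x) (\<phi> y)" for x y
    by (simp add: w_le_def c_eq hom)
  have "w_object Q"
  proof
    fix X Y assume *: "X \<in> w_carrier Q" "Y \<in> w_carrier Q" "w_le Q (w_zero Q) X"
      "\<And>n. w_le Q (w_nmult Q n X) Y"
    then obtain x y where "X = c x" "Y = c y" by auto
    with * show "X = w_zero Q"
      using archimedean[of "\<phi> x" "\<phi> y"] by (simp add: Qmult Qle c_eq zero mult)
  next
    fix X assume *: "X \<in> w_carrier Q" "w_le Q (w_zero Q) X" "w_meet Q X (w_unit Q) = w_zero Q"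
    then obtain x where "X = c x" by auto
    with * show "X = w_zero Q"
      using weak_unit[of "\<phi> x"] by (simp add: Qle c_eq zero hom)
  next
    show "w_le Q (w_zero Q) (w_unit Q)" using unit_nonneg by (simp add: Qle zero hom)
  qed (auto simp: add.assoc add.commute add.left_commute inf_aci sup_aci
      add_inf_distrib_left add_sup_distrib_left)
  moreover have "w_morphism (type_w e) Q c"
    by (simp add: w_morphism_def type_w_def)
  moreover have "{x. \<phi> x = w_zero H} = {x. c x = w_zero Q}"
    by (simp add: c_eq zero)
  ultimately show ?thesis unfolding w_kernel_def by blast
qed

text \<open>\<open>[S]\<close>, the smallest kernel containing \<open>S\<close>\<close>

definition kgen :: "'a::lattice_ab_group_add \<Rightarrow> 'a set \<Rightarrow> 'a set" where
  "kgen e S = w_kernel e hull S"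

text \<open>The Madden frame is the set of kernels ordered by inclusion: its top is \<open>UNIV\<close>, its
  binary meet is intersection, and the join of a family is generated by the union.\<close>

definition madden_frame :: "'a::lattice_ab_group_add \<Rightarrow> 'a set set" where
  "madden_frame e = {K. w_kernel e K}"

definition kJoin :: "'a::lattice_ab_group_add \<Rightarrow> 'a set set \<Rightarrow> 'a set" where
  "kJoin e \<K> = kgen e (\<Union>\<K>)"


section \<open>Frame maps from the open sets of reals to the Madden frame\<close>

definition RL :: "'a::lattice_ab_group_add \<Rightarrow> (real set \<Rightarrow> 'a set) set" where
  "RL e = {f. f \<in> {U. open U} \<rightarrow>\<^sub>E madden_frame e \<and>
     f UNIV = UNIV \<and>
     (\<forall>U V. open U \<longrightarrow> open V \<longrightarrow> f (U \<inter> V) = f U \<inter> f V) \<and>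
     (\<forall>\<U>. (\<forall>U\<in>\<U>. open U) \<longrightarrow> f (\<Union>\<U>) = kJoin e (f ` \<U>))}"

definition RL_const :: "'a::lattice_ab_group_add \<Rightarrow> real \<Rightarrow> real set \<Rightarrow> 'a set" where
  "RL_const e r = (\<lambda>U\<in>{U. open U}. if r \<in> U then UNIV else kJoin e {})"

definition RL_lift2 :: "'a::lattice_ab_group_add \<Rightarrow> (real \<Rightarrow> real \<Rightarrow> real) \<Rightarrow>
    (real set \<Rightarrow> 'a set) \<Rightarrow> (real set \<Rightarrow> 'a set) \<Rightarrow> real set \<Rightarrow> 'a set" where
  "RL_lift2 e w f g = (\<lambda>U\<in>{U. open U}.
     kJoin e {f V \<inter> g W | V W. open V \<and> open W \<and> (\<forall>x\<in>V. \<forall>y\<in>W. w x y \<in> U)})"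

definition RL_meet :: "'a::lattice_ab_group_add \<Rightarrow>
    (real set \<Rightarrow> 'a set) \<Rightarrow> (real set \<Rightarrow> 'a set) \<Rightarrow> real set \<Rightarrow> 'a set" where
  "RL_meet e = RL_lift2 e min"

definition RL_le :: "(real set \<Rightarrow> 'a set) \<Rightarrow> (real set \<Rightarrow> 'a set) \<Rightarrow> bool" where
  "RL_le f g \<longleftrightarrow> (\<forall>r. f {r<..} \<subseteq> g {r<..})"


section \<open>The Madden representation\<close>

text \<open>A frame map on the open sets of reals is determined by its values on the rays
  \<open>{r<..}\<close>. The group need not contain the constant \<open>r\<close>, so the generator \<open>(g - r)\<^sup>+\<close> is
  scaled to \<open>(q g - p 1)\<^sup>+\<close> for \<open>r = p/q\<close>, and irrational \<open>r\<close> are approached from above.\<close>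

definition ray_kernel :: "'a::lattice_ab_group_add \<Rightarrow> 'a \<Rightarrow> int \<Rightarrow> nat \<Rightarrow> 'a set" where
  "ray_kernel e g p q = kgen e {sup (nmult q g - imult p e) 0}"

definition madden_rep :: "'a::lattice_ab_group_add \<Rightarrow> 'a \<Rightarrow> real set \<Rightarrow> 'a set" where
  "madden_rep e g = (THE f. f \<in> RL e \<and>
     (\<forall>p q. 0 < q \<longrightarrow> f {of_int p / of_nat q<..} = ray_kernel e g p q) \<and>
     (\<forall>r. f {r<..} = kJoin e {ray_kernel e g p q | p q. 0 < q \<and> r < of_int p / of_nat q}))"

end

(* The W-kernels are the solid subgroups closed under two conditions, an archimedean one and one
   on the weak unit. Relative polars {x. |x| meet a : M} of kernels are kernels, which yields the
   frame law. The kernels of (g - r)^+ and (r - g)^+ form a Dedekind cut in the frame, so a frame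
   map with the prescribed values on rays exists, and it is unique. Meeting h with the constant c
   is composition of h with the preimage under min(-, c), and truncating g by n in G has the same
   effect on the Madden representation. Hence (1) follows from injectivity and (2) from
   continuity of h along the cover of the line by the rays below n. Conversely h is glued from
   the truncates restricted to the rays below n. *)

theory Submission
  imports Defs
begin

section \<open>Multiples and positive parts\<close>

text \<open>A generated kernel is available only as an intersection of kernels, so the members of a
  join are never written down. To bound a join, one exhibits a kernel that contains its generators;
  this is what the relative polars supply. Their consequence \<open>kernel_subset_of_cover\<close>
  allows an inclusion to be tested piecewise on a cover of the top, as one argues locally on a
  space. It serves for the uniqueness of frame maps, for preservation of unions, for injectivity and
  for gluing. Beyond the study of kernels themselves, the archimedean condition enters three times:
  the kernel of a rational ray is the join of those of the smaller rays, the rays of one element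
  cover the top, and an element whose multiples all stay below \<open>nmult 2 e\<close> is not
  positive. The weak unit condition enters through \<open>kernel_eq_UNIV\<close>: a cover of the top
  is detected by the single element \<open>e\<close>.\<close>

lemma nmult_0 [simp]: "nmult 0 x = 0"
  and nmult_Suc: "nmult (Suc n) x = x + nmult n x"
  by (simp_all add: nmult_def)

lemma nmult_add: "nmult (m + n) x = nmult m x + nmult n x"
  by (induction m) (simp_all add: nmult_Suc add.assoc)

lemma nmult_add_right: "nmult n (x + y) = nmult n x + nmult n y"
  by (induction n) (simp_all add: nmult_Suc algebra_simps)

lemma nmult_minus: "nmult n (- x) = - nmult n x"
  by (induction n) (simp_all add: nmult_Suc)

lemma nmult_diff_right: "nmult n (x - y) = nmult n x - nmult n y"
  using nmult_add_right[of n x "- y"] by (simp add: nmult_minus)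

lemma nmult_mult: "nmult (m * n) x = nmult m (nmult n x)"
  by (induction m) (simp_all add: nmult_Suc nmult_add)

lemma nmult_mono: "x \<le> y \<Longrightarrow> nmult n x \<le> nmult n y"
  by (induction n) (simp_all add: nmult_Suc add_mono)

lemma nmult_nonneg: "0 \<le> x \<Longrightarrow> 0 \<le> nmult n x"
  by (induction n) (simp_all add: nmult_Suc)

lemma nmult_1 [simp]: "nmult (Suc 0) x = x"
  by (simp add: nmult_Suc)

lemma imult_diff: "imult (int m - int n) x = nmult m x - nmult n x"
proof (cases "n \<le> m")
  case True
  then obtain k where "m = n + k" using le_Suc_ex by blast
  then show ?thesis by (simp add: imult_def nmult_add)
next
  case False
  then obtain k where "n = m + k" using le_Suc_ex by fastforce
  then show ?thesis using False by (simp add: imult_def nmult_add)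
qed

lemma imult_of_nat: "imult (int m) x = nmult m x"
  using imult_diff[of m 0] by simp

lemma imult_add: "imult (a + b) x = imult a x + imult b x"
proof -
  obtain m n k l where "a = int m - int n" "b = int k - int l" by (metis int_diff_cases)
  moreover from this have "a + b = int (m + k) - int (n + l)" by simp
  ultimately show ?thesis unfolding imult_diff by (simp only: imult_diff nmult_add) simp
qed

lemma imult_minus: "imult (- a) x = - imult a x"
  using imult_add[of a "- a" x] by (simp add: imult_def eq_neg_iff_add_eq_0 add.commute)

lemma imult_mult: "imult (int k * a) x = nmult k (imult a x)"
proof -
  obtain m n where "a = int m - int n" by (metis int_diff_cases)
  moreover from this have "int k * a = int (k * m) - int (k * n)"
    by (simp only: of_nat_mult right_diff_distrib)
  ultimately show ?thesis by (simp only: imult_diff nmult_mult nmult_diff_right)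
qed

lemma imult_mono: assumes "0 \<le> x" "a \<le> b" shows "imult a x \<le> imult b x"
proof -
  obtain k where "b = a + int k" using assms(2) zle_iff_zadd by blast
  then show ?thesis using assms(1) by (simp add: imult_add imult_of_nat nmult_nonneg)
qed

lemma pprt_add_le: "pprt (x + y) \<le> pprt x + pprt y"
  for x y :: "'a::lattice_ab_group_add"
  unfolding pprt_def by (intro le_supI add_mono add_nonneg_nonneg) auto

lemma pprt_diff_pprt_minus: "pprt x - pprt (- x) = x"
  for x :: "'a::lattice_ab_group_add"
  using prts[of x] by (simp add: pprt_neg)

lemma diff_inf_eq_pprt: "x - inf x y = pprt (x - y)"
  for x y :: "'a::lattice_ab_group_add"
  by (simp add: pprt_def add_sup_distrib_left sup_commute)

lemma inf_pprt_pprt_minus: "inf (pprt x) (pprt (- x)) = 0"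
  for x :: "'a::lattice_ab_group_add"
proof -
  have "inf (pprt x) (pprt (- x)) = inf (x + pprt (- x)) (0 + pprt (- x))"
    using pprt_diff_pprt_minus[of x] by (simp add: diff_eq_eq)
  also have "\<dots> = inf x 0 + pprt (- x)" by (simp only: add_inf_distrib_right)
  also have "\<dots> = 0" unfolding pprt_neg nprt_def by (rule right_minus)
  finally show ?thesis .
qed

text \<open>Distributing addition over both meets turns the right side into the meet of
  \<open>a + a\<close>, \<open>b + a\<close>, \<open>a + c\<close> and \<open>b + c\<close>, each of
  which dominates \<open>a\<close> or \<open>b + c\<close>.\<close>

lemma inf_add_le:
  fixes a b c :: "'a::lattice_ab_group_add"
  assumes "0 \<le> a" "0 \<le> b" "0 \<le> c"
  shows "inf a (b + c) \<le> inf a b + inf a c"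
proof -
  have "a \<le> a + a" "a \<le> a + c" "a \<le> b + a" using assms by simp_all
  then have "inf a (b + c) \<le> inf (inf (a + a) (b + a)) (inf (a + c) (b + c))"
    by (auto intro: le_infI1 le_infI2)
  then show ?thesis by (simp add: add_inf_distrib_left add_inf_distrib_right)
qed

lemma inf_nmult_le:
  fixes a b :: "'a::lattice_ab_group_add"
  assumes "0 \<le> a" "0 \<le> b"
  shows "inf a (nmult n b) \<le> nmult n (inf a b)"
proof (induction n)
  case (Suc n)
  have "inf a (nmult (Suc n) b) \<le> inf a b + inf a (nmult n b)"
    unfolding nmult_Suc using assms by (intro inf_add_le nmult_nonneg)
  with Suc show ?case unfolding nmult_Suc by (meson add_left_mono order_trans)
qed (simp add: assms)

lemma pprt_diff_of_disjoint: "inf a b = 0 \<Longrightarrow> pprt (a - b) = a"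
  for a b :: "'a::lattice_ab_group_add"
  using diff_inf_eq_pprt[of a b] by simp

text \<open>The positive and negative parts of \<open>x\<close> are disjoint, and so are their
  \<open>n\<close>-fold multiples; in a difference of disjoint elements the minuend is the positive
  part.\<close>

lemma pprt_nmult: "pprt (nmult n x) = nmult n (pprt x)"
proof -
  let ?a = "pprt x" and ?b = "pprt (- x)"
  have z: "nmult n 0 = (0::'a)" by (induction n) (simp_all add: nmult_Suc)
  have 1: "inf ?a (nmult n ?b) = 0"
    using inf_nmult_le[of ?a ?b n] by (simp add: inf_pprt_pprt_minus z nmult_nonneg antisym)
  have "inf (nmult n ?b) (nmult n ?a) \<le> nmult n (inf (nmult n ?b) ?a)"
    by (intro inf_nmult_le nmult_nonneg) simp_all
  then have "inf (nmult n ?a) (nmult n ?b) = 0"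
    using 1 by (simp add: inf_commute z nmult_nonneg antisym)
  then have "pprt (nmult n ?a - nmult n ?b) = nmult n ?a" by (rule pprt_diff_of_disjoint)
  then show ?thesis by (simp only: nmult_diff_right[symmetric] pprt_diff_pprt_minus)
qed

text \<open>An instance of lattice distributivity, drawn from the group structure:
  \<open>pprt w\<close> exceeds \<open>pprt ?z\<close> by at most \<open>w - ?z\<close>, and the
  meet of these excesses over \<open>w = x\<close> and \<open>w = y\<close> is zero.\<close>

lemma pprt_inf: "pprt (inf x y) = inf (pprt x) (pprt y)"
  for x y :: "'a::lattice_ab_group_add"
proof (rule antisym)
  let ?z = "inf x y"
  have *: "pprt w \<le> pprt ?z + (w - ?z)" if "?z \<le> w" for w
    using pprt_add_le[of ?z "w - ?z"] that by (simp del: diff_inf_eq_sup)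
  have "inf (pprt x) (pprt y) \<le> inf (pprt ?z + (x - ?z)) (pprt ?z + (y - ?z))"
    by (intro inf_mono *) simp_all
  also have "\<dots> = pprt ?z + (inf x y - ?z)"
    unfolding diff_conv_add_uminus by (simp only: add_inf_distrib_left add_inf_distrib_right)
  finally show "inf (pprt x) (pprt y) \<le> pprt ?z" by simp
qed simp

text \<open>Both sides are compared with twice the meet of \<open>x\<close> and \<open>y\<close>,
  which lies below \<open>x + y\<close>.\<close>

lemma inf_pprt_le: "inf (pprt x) (pprt y) \<le> pprt (x + y)"
  for x y :: "'a::lattice_ab_group_add"
proof -
  let ?z = "inf x y"
  have "pprt ?z \<le> nmult 2 (pprt ?z)" by (simp add: numeral_2_eq_2 nmult_Suc)
  also have "\<dots> = pprt (?z + ?z)" by (simp add: pprt_nmult[symmetric] numeral_2_eq_2 nmult_Suc)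
  also have "\<dots> \<le> pprt (x + y)" by (intro pprt_mono add_mono) simp_all
  finally show ?thesis by (simp only: pprt_inf)
qed

section \<open>Absolute values and Lipschitz estimates\<close>

text \<open>The absolute value; \<open>abs\<close> is not an operation of this class.\<close>

definition mag :: "'a \<Rightarrow> 'a::lattice_ab_group_add" where
  "mag x = pprt x + pprt (- x)"

lemma mag_nonneg [simp]: "0 \<le> mag x" by (simp add: mag_def)
lemma mag_minus [simp]: "mag (- x) = mag x" by (simp add: mag_def add.commute)
lemma pprt_le_mag: "pprt x \<le> mag x" by (simp add: mag_def)
lemma mag_of_nonneg [simp]: "0 \<le> x \<Longrightarrow> mag x = x" by (simp add: mag_def)

lemma mag_add_le: "mag (x + y) \<le> mag x + mag y"
proof -
  have "mag (x + y) \<le> (pprt x + pprt y) + (pprt (- x) + pprt (- y))"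
    unfolding mag_def using pprt_add_le[of "- x" "- y"] by (intro add_mono pprt_add_le) simp
  then show ?thesis by (simp add: mag_def algebra_simps)
qed

text \<open>Raising \<open>x'\<close> and \<open>y'\<close> by one common nonnegative
  \<open>?d\<close> lifts them above \<open>x\<close> and \<open>y\<close>, and a common translation
  passes through the meet. The estimate makes meets well defined modulo a solid subgroup.\<close>

lemma mag_inf_diff_le: "mag (inf x y - inf x' y') \<le> mag (x - x') + mag (y - y')"
proof -
  have *: "pprt (inf x y - inf x' y') \<le> pprt (x - x') + pprt (y - y')" for x y x' y' :: 'a
  proof -
    let ?d = "pprt (x - x') + pprt (y - y')"
    have "x - x' \<le> ?d" "y - y' \<le> ?d"
      by (metis add_increasing2 pprt_def sup_ge1 zero_le_pprt)
         (metis add_increasing pprt_def sup_ge1 zero_le_pprt)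
    then have "inf x y \<le> inf (x' + ?d) (y' + ?d)"
      by (auto simp: diff_le_eq add.commute intro: le_infI1 le_infI2)
    then show ?thesis
      unfolding pprt_def[of "inf x y - _"]
      by (simp add: add_inf_distrib_right[symmetric] diff_le_eq add.commute del: diff_inf_eq_sup)
  qed
  show ?thesis using add_mono[OF *[of x y x' y'] *[of x' y' x y]]
    by (simp add: mag_def algebra_simps del: diff_inf_eq_sup neg_inf_eq_sup)
qed

lemma mag_sup_diff_le: "mag (sup x y - sup x' y') \<le> mag (x - x') + mag (y - y')"
proof -
  have "sup x y - sup x' y' = - (inf (-x) (-y) - inf (-x') (-y'))"
    by (simp add: sup_eq_neg_inf del: neg_inf_eq_sup diff_inf_eq_sup)
  then have "mag (sup x y - sup x' y') = mag (inf (-x) (-y) - inf (-x') (-y'))"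
    by (metis mag_minus)
  also have "\<dots> \<le> mag (-x - -x') + mag (-y - -y')" by (rule mag_inf_diff_le)
  also have "\<dots> = mag (- (x - x')) + mag (- (y - y'))" by simp
  finally show ?thesis by (simp only: mag_minus)
qed

section \<open>Kernels\<close>

text \<open>Membership of \<open>pprt (u - v)\<close> in \<open>K\<close> means that
  \<open>u\<close> lies below \<open>v\<close> in the quotient by \<open>K\<close>. Thus
  \<open>arch_mem\<close> says that the quotient is archimedean, and \<open>unit_mem\<close> that
  the image of \<open>e\<close> is a weak unit there. Nonnegative \<open>x\<close> suffice because
  nonnegative cosets have nonnegative representatives. Closure under negation comes from
  \<open>solid\<close>.\<close>

locale w_closed =
  fixes e :: "'a::lattice_ab_group_add" and K :: "'a set"
  assumes zero_mem: "0 \<in> K"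
    and add_mem: "\<lbrakk>x \<in> K; y \<in> K\<rbrakk> \<Longrightarrow> x + y \<in> K"
    and solid: "\<lbrakk>y \<in> K; mag x \<le> mag y\<rbrakk> \<Longrightarrow> x \<in> K"
    and arch_mem: "\<lbrakk>0 \<le> x; \<And>n. pprt (nmult n x - y) \<in> K\<rbrakk> \<Longrightarrow> x \<in> K"
    and unit_mem: "\<lbrakk>0 \<le> x; inf x e \<in> K\<rbrakk> \<Longrightarrow> x \<in> K"
begin

lemma minus_mem: "x \<in> K \<Longrightarrow> - x \<in> K"
  by (rule solid) auto

lemma mag_mem: "x \<in> K \<Longrightarrow> mag x \<in> K"
  by (rule solid[of x]) auto

lemma between_mem: "\<lbrakk>y \<in> K; 0 \<le> x; x \<le> y\<rbrakk> \<Longrightarrow> x \<in> K"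
  by (rule solid[of y]) (auto simp: order_trans[of 0 x y])

lemma mem_of_mag: "mag x \<in> K \<Longrightarrow> x \<in> K"
  by (rule solid) auto

lemma nmult_mem: "x \<in> K \<Longrightarrow> nmult n x \<in> K"
  by (induction n) (auto simp: nmult_Suc zero_mem add_mem)

end

lemma w_kernel_imp_w_closed:
  assumes "w_kernel e K"
  shows "w_closed e K"
proof -
  obtain H :: "'a set w_struct" and \<phi> where H: "w_object H" and \<phi>: "w_morphism (type_w e) H \<phi>"
    and K: "K = {x. \<phi> x = w_zero H}"
    using assms unfolding w_kernel_def by blast
  interpret w_object H by (fact H)
  have car [simp]: "\<phi> x \<in> w_carrier H" for x
    using \<phi> by (simp add: w_morphism_def type_w_def)
  have hom: "\<phi> (x + y) = w_add H (\<phi> x) (\<phi> y)" "\<phi> (inf x y) = w_meet H (\<phi> x) (\<phi> y)"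
    "\<phi> (sup x y) = w_join H (\<phi> x) (\<phi> y)" "\<phi> e = w_unit H" for x y
    using \<phi> by (simp_all add: w_morphism_def type_w_def)
  have zero: "\<phi> 0 = w_zero H"
    by (metis add.right_neutral add_assoc add_neg add_zero car hom(1) neg_closed)
  have minus: "\<phi> (- x) = w_zero H" if "\<phi> x = w_zero H" for x
    by (metis add.right_inverse add_zero car hom(1) that zero)
  have mult: "\<phi> (nmult n x) = w_nmult H n (\<phi> x)" for n x
    by (induction n) (simp_all add: nmult_def w_nmult_def zero hom)
  have pprt: "\<phi> (pprt x) = w_zero H" if "\<phi> x = w_zero H" for x
    by (metis hom(3) pprt_0 pprt_def that zero)
  have add: "\<phi> (x + y) = w_zero H" if "\<phi> x = w_zero H" "\<phi> y = w_zero H" for x y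
    by (metis hom(1) add.right_neutral that zero)
  have between: "\<phi> x = w_zero H" if "0 \<le> x" "x \<le> y" "\<phi> y = w_zero H" for x y
  proof -
    have "\<phi> (inf x y) = \<phi> (inf x 0)" unfolding hom(2) by (simp add: that zero)
    with that(1,2) show ?thesis by (simp add: inf_absorb1 inf_absorb2 zero)
  qed
  \<comment> \<open>The element \<open>x\<close> is the sum of \<open>pprt (x - y)\<close> and
    \<open>inf x y\<close>, so killing the first summand identifies \<open>x\<close> with the
    meet.\<close>
  have le: "w_le H (\<phi> x) (\<phi> y)" if "\<phi> (pprt (x - y)) = w_zero H" for x y
  proof -
    have "\<phi> (inf x y) = \<phi> (pprt (x - y) + inf x y)"
      unfolding hom(1) that by (simp add: add_zero)
    also have "pprt (x - y) + inf x y = x" by (simp only: diff_inf_eq_pprt[symmetric] diff_add_cancel)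
    finally show ?thesis unfolding w_le_def hom(2) .
  qed
  show ?thesis unfolding K
  proof (unfold_locales; unfold mem_Collect_eq)
    fix x y assume "\<phi> y = w_zero H" "mag x \<le> mag y"
    moreover from this have "\<phi> (mag y) = w_zero H"
      unfolding mag_def by (intro add pprt minus)
    \<comment> \<open>Stated for every \<open>z\<close> with the magnitude of \<open>x\<close>, so
      that it yields both parts of \<open>x\<close>, from \<open>z = x\<close> and
      \<open>z = - x\<close>.\<close>
    ultimately have p: "\<phi> (pprt z) = w_zero H" if "mag z = mag x" for z
      using order_trans[OF pprt_le_mag[of z], of "mag y"] that
      by (intro between[of "pprt z" "mag y"]) simp_all
    have "\<phi> (pprt x + - pprt (- x)) = w_zero H" by (intro add minus p) simp_all
    then show "\<phi> x = w_zero H" by (simp add: pprt_diff_pprt_minus)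
  next
    fix x y assume x: "0 \<le> x" and arch: "\<And>n. \<phi> (pprt (nmult n x - y)) = w_zero H"
    have "w_le H (\<phi> 0) (\<phi> x)" using x by (intro le) (simp add: zero)
    moreover have "w_le H (w_nmult H n (\<phi> x)) (\<phi> y)" for n
      unfolding mult[symmetric] by (intro le arch)
    ultimately show "\<phi> x = w_zero H" by (intro archimedean[of "\<phi> x" "\<phi> y"]) (simp_all add: zero)
  next
    fix x assume x: "0 \<le> x" and unit: "\<phi> (inf x e) = w_zero H"
    have "w_le H (\<phi> 0) (\<phi> x)" using x by (intro le) (simp add: zero)
    with unit show "\<phi> x = w_zero H"
      by (metis car hom(2,4) weak_unit zero)
  qed (auto simp: zero add)
qed

text \<open>The codomain is the quotient by \<open>K\<close>, with operations computed on chosen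
  representatives of the cosets; the Lipschitz estimates make the choice immaterial.\<close>

lemma w_closed_imp_w_kernel:
  fixes e :: "'a::lattice_ab_group_add"
  assumes K: "w_closed e K" and e: "0 \<le> e"
  shows "w_kernel e K"
proof -
  interpret w_closed e K by (fact K)
  define c where "c x = {y. y - x \<in> K}" for x
  define r where "r X = (SOME x. x \<in> X)" for X :: "'a set"
  have c_eq: "c x = c y \<longleftrightarrow> x - y \<in> K" for x y
  proof
    assume "c x = c y"
    moreover have "x \<in> c x" by (simp add: c_def zero_mem)
    ultimately show "x - y \<in> K" by (simp add: c_def)
  next
    assume "x - y \<in> K"
    then have "z - x \<in> K \<longleftrightarrow> z - y \<in> K" for z
      using add_mem[of "z - x" "x - y"] add_mem[of "z - y" "- (x - y)"] minus_mem[of "x - y"] by auto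
    then show "c x = c y" unfolding c_def by simp
  qed
  have r: "r (c x) - x \<in> K" for x
    unfolding r_def c_def by (rule someI2[of _ x]) (auto simp: zero_mem)
  have cong2: "f (r (c x)) (r (c y)) - f x y \<in> K"
    if "\<And>x y x' y'. mag (f x y - f x' y') \<le> mag (x - x') + mag (y - y')" for f x y
    using solid[OF add_mem[OF mag_mem[OF r] mag_mem[OF r]], of "f (r (c x)) (r (c y)) - f x y" x y]
      that[of "r (c x)" "r (c y)" x y] by simp
  define Q where "Q = \<lparr>w_carrier = range c, w_add = (\<lambda>X Y. c (r X + r Y)), w_zero = c 0,
     w_neg = (\<lambda>X. c (- r X)), w_meet = (\<lambda>X Y. c (inf (r X) (r Y))),
     w_join = (\<lambda>X Y. c (sup (r X) (r Y))), w_unit = c e\<rparr>"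
  have "mag (x + y - (x' + y')) \<le> mag (x - x') + mag (y - y')" for x y x' y' :: 'a
    using mag_add_le[of "x - x'" "y - y'"] by (simp add: algebra_simps)
  then have Q [simp]: "w_carrier Q = range c" "w_zero Q = c 0" "w_unit Q = c e"
    "w_add Q (c x) (c y) = c (x + y)" "w_neg Q (c x) = c (- x)"
    "w_meet Q (c x) (c y) = c (inf x y)" "w_join Q (c x) (c y) = c (sup x y)" for x y
    using minus_mem[OF r[of x]] cong2[of "(+)" x y]
    by (simp_all add: Q_def c_eq cong2 mag_inf_diff_le mag_sup_diff_le
      del: diff_inf_eq_sup diff_sup_eq_inf)
  have Qmult: "w_nmult Q n (c x) = c (nmult n x)" for n x
    by (induction n) (simp_all add: nmult_def w_nmult_def)
  have Qle: "w_le Q (c x) (c y) \<longleftrightarrow> pprt (x - y) \<in> K" for x y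
    using minus_mem[of "inf x y - x"] minus_mem[of "x - inf x y"]
    by (auto simp add: w_le_def c_eq diff_inf_eq_pprt[symmetric] simp del: diff_inf_eq_sup)
  \<comment> \<open>A coset above zero has a representative \<open>x\<close> with
    \<open>pprt (- x)\<close> in \<open>K\<close>; subtracting the negative part, that is, passing
    to \<open>pprt x\<close>, stays in the coset.\<close>
  have nonneg_rep: "\<exists>x\<ge>0. X = c x" if "X \<in> range c" "w_le Q (c 0) X" for X
  proof -
    obtain x where "X = c x" using \<open>X \<in> range c\<close> by blast
    with that(2) have "c (pprt x) = X"
      using pprt_diff_pprt_minus[of x] by (simp add: Qle c_eq algebra_simps)
    then show ?thesis by (metis zero_le_pprt)
  qed
  have "w_object Q"
  proof
    fix X Y assume *: "X \<in> w_carrier Q" "Y \<in> w_carrier Q" "w_le Q (w_zero Q) X"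
      "\<And>n. w_le Q (w_nmult Q n X) Y"
    obtain x where "X = c x" "0 \<le> x" using * nonneg_rep[of X] by auto
    moreover obtain y where "Y = c y" using * by auto
    moreover note *
    ultimately show "X = w_zero Q"
      using arch_mem[of x y] by (simp add: Qmult Qle c_eq)
  next
    fix X assume *: "X \<in> w_carrier Q" "w_le Q (w_zero Q) X" "w_meet Q X (w_unit Q) = w_zero Q"
    obtain x where "X = c x" "0 \<le> x" using * nonneg_rep[of X] by auto
    with * show "X = w_zero Q"
      using unit_mem[of x] by (simp add: c_eq)
  next
    show "w_le Q (w_zero Q) (w_unit Q)" using e by (simp add: Qle zero_mem)
  qed (auto simp: add.assoc add.commute add.left_commute inf_aci sup_aci
      add_inf_distrib_left add_sup_distrib_left)
  moreover have "w_morphism (type_w e) Q c"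
    by (simp add: w_morphism_def type_w_def)
  moreover have "K = {x. c x = w_zero Q}"
    by (simp add: c_eq)
  ultimately show ?thesis unfolding w_kernel_def by blast
qed

section \<open>The frame of kernels\<close>

locale madden =
  fixes e :: "'a::lattice_ab_group_add"
  assumes w_object_type: "w_object (type_w e)"
begin

lemma unit_nonneg: "0 \<le> e"
proof -
  interpret w_object "type_w e" by (rule w_object_type)
  show ?thesis using unit_nonneg by (simp add: w_le_def type_w_def le_iff_inf)
qed

lemma w_kernel_iff: "w_kernel e K \<longleftrightarrow> w_closed e K"
  using w_kernel_imp_w_closed w_closed_imp_w_kernel unit_nonneg by blast

lemma kernel_zero: "w_kernel e {0}"
proof -
  have "w_morphism (type_w e) (type_w e) id" by (simp add: w_morphism_def)
  from w_kernel_any_codomain[OF w_object_type this] show ?thesis by (simp add: type_w_def)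
qed

lemma kernel_Inter:
  assumes "\<And>K. K \<in> \<K> \<Longrightarrow> w_kernel e K"
  shows "w_kernel e (\<Inter>\<K>)"
proof -
  have c: "w_closed e K" if "K \<in> \<K>" for K using assms that w_kernel_iff by blast
  show ?thesis unfolding w_kernel_iff
    by unfold_locales (auto intro: c[THEN w_closed.zero_mem] c[THEN w_closed.add_mem]
      c[THEN w_closed.solid] c[THEN w_closed.arch_mem] c[THEN w_closed.unit_mem])
qed

lemma kernel_Int: "w_kernel e K \<Longrightarrow> w_kernel e M \<Longrightarrow> w_kernel e (K \<inter> M)"
  using kernel_Inter[of "{K, M}"] by auto

lemma kernel_kgen: "w_kernel e (kgen e S)"
  unfolding kgen_def by (rule hull_in) (blast intro: kernel_Inter)

lemma kernel_kJoin: "w_kernel e (kJoin e \<K>)"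
  unfolding kJoin_def by (rule kernel_kgen)

lemma kgen_subset_iff: "w_kernel e K \<Longrightarrow> kgen e S \<subseteq> K \<longleftrightarrow> S \<subseteq> K"
  unfolding kgen_def by (rule subset_hull)

lemma kgen_superset: "S \<subseteq> kgen e S"
  unfolding kgen_def by (rule hull_subset)

lemma kJoin_subset_iff: "w_kernel e K \<Longrightarrow> kJoin e \<K> \<subseteq> K \<longleftrightarrow> (\<forall>X\<in>\<K>. X \<subseteq> K)"
  unfolding kJoin_def by (auto simp: kgen_subset_iff)

lemma kJoin_upper: "X \<in> \<K> \<Longrightarrow> X \<subseteq> kJoin e \<K>"
  using kJoin_subset_iff[OF kernel_kJoin] by blast

text \<open>Each nonnegative \<open>x\<close> meets \<open>e\<close> in an element below
  \<open>e\<close>, hence in \<open>K\<close>, and the weak unit condition then returns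
  \<open>x\<close> itself.\<close>

lemma kernel_eq_UNIV:
  assumes "w_kernel e K" "e \<in> K"
  shows "K = UNIV"
proof -
  interpret w_closed e K using assms w_kernel_iff by blast
  have "x \<in> K" if "0 \<le> x" for x
    using unit_mem[OF that between_mem[OF assms(2)]] that unit_nonneg by simp
  then show ?thesis using mem_of_mag by auto
qed

text \<open>Only the archimedean clause is delicate: its hypothesis bounds multiples of
  \<open>x\<close>, whereas its conclusion concerns \<open>inf x a\<close>.\<close>

lemma kernel_polar:
  assumes "w_kernel e M" and a: "0 \<le> a"
  shows "w_kernel e {x. inf (mag x) a \<in> M}"
proof -
  interpret w_closed e M using assms w_kernel_iff by blast
  show ?thesis unfolding w_kernel_iff
  proof (unfold_locales; unfold mem_Collect_eq)
    show "inf (mag 0) a \<in> M" using a zero_mem by (simp add: mag_def inf_absorb1)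
  next
    fix x y assume "inf (mag x) a \<in> M" "inf (mag y) a \<in> M"
    then have *: "inf a (mag x) + inf a (mag y) \<in> M" by (simp add: add_mem inf_commute)
    have "inf (mag (x + y)) a \<le> inf a (mag x + mag y)"
      using mag_add_le by (auto intro: le_infI1)
    also have "\<dots> \<le> inf a (mag x) + inf a (mag y)" using a by (intro inf_add_le) simp_all
    finally show "inf (mag (x + y)) a \<in> M" using a by (intro between_mem[OF *]) simp_all
  next
    fix x y assume *: "inf (mag y) a \<in> M" and "mag x \<le> mag y"
    then show "inf (mag x) a \<in> M" using a
      by (intro between_mem[OF *]) (auto intro: le_infI1)
  next
    fix x y assume x: "0 \<le> x" and *: "\<And>n. inf (mag (pprt (nmult n x - y))) a \<in> M"
    \<comment> \<open>This positive part lies below \<open>pprt (nmult n x - y)\<close> and also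
      below \<open>nmult n a\<close>, hence below \<open>n\<close> times a meet that is in
      \<open>M\<close>. The bound is \<open>pprt y\<close> and not \<open>y\<close> so that
      subtracting it cannot push the element above \<open>nmult n a\<close>.\<close>
    have "pprt (nmult n (inf x a) - pprt y) \<in> M" for n
    proof (rule between_mem)
      let ?z = "nmult n (inf x a)"
      show "nmult n (inf (pprt (nmult n x - y)) a) \<in> M" using *[of n] by (simp add: nmult_mem)
      have "nmult n (inf x a) - pprt y \<le> nmult n x - y"
        by (intro diff_mono nmult_mono) (simp_all add: pprt_def)
      then have 1: "pprt (?z - pprt y) \<le> pprt (nmult n x - y)" by simp
      have "?z - pprt y \<le> nmult n a - 0" by (intro diff_mono nmult_mono) simp_all
      then have 2: "pprt (?z - pprt y) \<le> nmult n a"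
        using a by (simp add: pprt_def nmult_nonneg)
      from 1 2 have "pprt (?z - pprt y) \<le> inf (pprt (nmult n x - y)) (nmult n a)" by simp
      also have "\<dots> \<le> nmult n (inf (pprt (nmult n x - y)) a)"
        using a by (intro inf_nmult_le) simp_all
      finally show "pprt (?z - pprt y) \<le> nmult n (inf (pprt (nmult n x - y)) a)" .
    qed simp
    then have "inf x a \<in> M" using x a by (intro arch_mem[of "inf x a" "pprt y"]) simp_all
    then show "inf (mag x) a \<in> M" using x by simp
  next
    fix x assume "0 \<le> x" "inf (mag (inf x e)) a \<in> M"
    then show "inf (mag x) a \<in> M"
      using unit_mem[of "inf x a"] a unit_nonneg by (simp add: inf_aci)
  qed
qed

lemma kernel_Int_mag:
  assumes "w_kernel e K" "w_kernel e L" "x \<in> K" "y \<in> L"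
  shows "inf (mag x) (mag y) \<in> K \<inter> L"
proof -
  have "w_closed e K" "w_closed e L" using assms w_kernel_iff by blast+
  then show ?thesis using assms(3,4)
    by (auto intro: w_closed.between_mem[OF _ w_closed.mag_mem])
qed

text \<open>This is the frame law. For a fixed \<open>a\<close> on the left, the polar of
  \<open>mag a\<close> relative to \<open>M\<close> is a kernel that contains every
  \<open>X\<close>, hence the join, hence \<open>a\<close>; and \<open>a\<close> in its own relative
  polar means that \<open>mag a\<close> is in \<open>M\<close>.\<close>

lemma kJoin_Int_subset:
  assumes M: "w_kernel e M" and A: "\<And>X. X \<in> \<A> \<Longrightarrow> w_kernel e X" and K: "w_kernel e K"
    and sub: "\<And>X. X \<in> \<A> \<Longrightarrow> X \<inter> K \<subseteq> M"
  shows "kJoin e \<A> \<inter> K \<subseteq> M"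
proof
  fix a assume a: "a \<in> kJoin e \<A> \<inter> K"
  have "kJoin e \<A> \<subseteq> {x. inf (mag x) (mag a) \<in> M}"
    using kernel_Int_mag[OF A K] a sub
    by (subst kJoin_subset_iff[OF kernel_polar[OF M]]) (simp, blast)
  then have "mag a \<in> M" using a by auto
  with M show "a \<in> M" using w_closed.mem_of_mag w_kernel_iff by blast
qed

lemma kJoin_Int_kJoin_subset:
  assumes "w_kernel e M" "\<And>X. X \<in> \<A> \<Longrightarrow> w_kernel e X" "\<And>Y. Y \<in> \<B> \<Longrightarrow> w_kernel e Y"
    and sub: "\<And>X Y. X \<in> \<A> \<Longrightarrow> Y \<in> \<B> \<Longrightarrow> X \<inter> Y \<subseteq> M"
  shows "kJoin e \<A> \<inter> kJoin e \<B> \<subseteq> M"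
proof (rule kJoin_Int_subset[OF assms(1,2) kernel_kJoin])
  fix X assume X: "X \<in> \<A>"
  have "kJoin e \<B> \<inter> X \<subseteq> M"
    using assms(1-3) X sub[OF X] by (intro kJoin_Int_subset) (simp_all add: Int_commute)
  then show "X \<inter> kJoin e \<B> \<subseteq> M" by blast
qed

text \<open>The frame law for a join equal to the top, in the form of a local-to-global
  principle.\<close>

lemma kernel_subset_of_cover:
  assumes "w_kernel e M" "\<And>X. X \<in> \<A> \<Longrightarrow> w_kernel e X" "w_kernel e K"
    and "kJoin e \<A> = UNIV" "\<And>X. X \<in> \<A> \<Longrightarrow> X \<inter> K \<subseteq> M"
  shows "K \<subseteq> M"
  using kJoin_Int_subset[where \<A> = \<A> and M = M and K = K] assms by simp

text \<open>The hard inclusion uses polars twice: first \<open>b\<close> is held fixed while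
  \<open>a\<close> is replaced by a member \<open>x\<close> of its kernel, then \<open>x\<close> is
  held fixed while \<open>b\<close> is replaced by \<open>x\<close>.\<close>

lemma kgen_Int_kgen:
  assumes "0 \<le> a" "0 \<le> b"
  shows "kgen e {a} \<inter> kgen e {b} = kgen e {inf a b}" (is "?L = ?R")
proof
  have ab: "a \<in> kgen e {a}" "b \<in> kgen e {b}" "inf a b \<in> ?R"
    using kgen_superset by blast+
  show "?R \<subseteq> ?L"
    using kernel_Int_mag[OF kernel_kgen kernel_kgen ab(1,2)] assms
    by (subst kgen_subset_iff) (auto simp: kernel_Int kernel_kgen)
  show "?L \<subseteq> ?R"
  proof
    fix x assume x: "x \<in> ?L"
    have "kgen e {a} \<subseteq> {x. inf (mag x) b \<in> ?R}"
      using assms ab by (subst kgen_subset_iff) (auto simp: kernel_polar kernel_kgen)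
    then have "inf b (mag x) \<in> ?R" using x by (auto simp: inf_commute)
    then have "kgen e {b} \<subseteq> {y. inf (mag y) (mag x) \<in> ?R}"
      using assms by (subst kgen_subset_iff) (auto simp: kernel_polar kernel_kgen)
    then have "mag x \<in> ?R" using x by auto
    then show "x \<in> ?R" using kernel_kgen w_closed.mem_of_mag w_kernel_iff by blast
  qed
qed

section \<open>Rays\<close>

lemma kgen_mono_le: "0 \<le> a \<Longrightarrow> a \<le> b \<Longrightarrow> kgen e {a} \<subseteq> kgen e {b}"
  using w_closed.between_mem[of e "kgen e {b}" b a] kgen_superset[of "{b}"]
  by (subst kgen_subset_iff) (auto simp: kernel_kgen w_kernel_iff[symmetric])

lemma kgen_nmult:
  assumes "0 \<le> a" "0 < k"
  shows "kgen e {nmult k a} = kgen e {a}"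
proof
  show "kgen e {nmult k a} \<subseteq> kgen e {a}"
    using w_closed.nmult_mem[of e "kgen e {a}" a k] kgen_superset[of "{a}"]
    by (subst kgen_subset_iff) (auto simp: kernel_kgen w_kernel_iff[symmetric])
  obtain j where "k = Suc j" using assms(2) gr0_implies_Suc by blast
  then show "kgen e {a} \<subseteq> kgen e {nmult k a}"
    using assms(1) by (intro kgen_mono_le) (simp_all add: nmult_Suc nmult_nonneg)
qed

lemma ray_kernel_eq: "ray_kernel e g p q = kgen e {pprt (nmult q g - imult p e)}"
  by (simp add: ray_kernel_def pprt_def)

lemma kernel_ray_kernel: "w_kernel e (ray_kernel e g p q)"
  unfolding ray_kernel_def by (rule kernel_kgen)

lemma pprt_mem_ray_kernel: "pprt (nmult q g - imult p e) \<in> ray_kernel e g p q"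
  unfolding ray_kernel_eq using kgen_superset by blast

text \<open>A positive multiple generates the same kernel, so only the value of the fraction matters
  and common denominators may be used.\<close>

lemma ray_kernel_scale: "0 < k \<Longrightarrow> ray_kernel e g (int k * p) (k * q) = ray_kernel e g p q"
  unfolding ray_kernel_eq imult_mult nmult_mult nmult_diff_right[symmetric] pprt_nmult
  by (rule kgen_nmult) simp_all

lemma ray_kernel_antimono:
  assumes q: "0 < q" "0 < q'" and le: "of_int p / of_nat q \<le> (of_int p' / of_nat q' :: real)"
  shows "ray_kernel e g p' q' \<subseteq> ray_kernel e g p q"
proof -
  have "real_of_int (int q' * p) \<le> real_of_int (int q * p')"
    using le q by (simp add: field_simps)
  then have "int q' * p \<le> int q * p'" by (simp only: of_int_le_iff)
  then have "ray_kernel e g (int q * p') (q * q') \<subseteq> ray_kernel e g (int q' * p) (q' * q)"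
    unfolding ray_kernel_eq
    by (intro kgen_mono_le pprt_mono diff_mono imult_mono unit_nonneg) (simp_all add: mult.commute)
  then show ?thesis using q by (simp only: ray_kernel_scale)
qed

text \<open>By antitonicity the worst case is that of opposite endpoints, where the generators are
  the positive parts of \<open>?x\<close> and \<open>- ?x\<close>.\<close>

lemma ray_kernel_disjoint:
  assumes q: "0 < q" "0 < q'" and le: "0 \<le> of_int p / of_nat q + (of_int p' / of_nat q' :: real)"
  shows "ray_kernel e g p q \<inter> ray_kernel e (- g) p' q' \<subseteq> {0}"
proof -
  let ?x = "nmult q g - imult p e"
  have "ray_kernel e (- g) p' q' \<subseteq> ray_kernel e (- g) (- p) q"
    using le q by (intro ray_kernel_antimono) simp_all
  moreover have "ray_kernel e (- g) (- p) q = kgen e {pprt (- ?x)}"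
    by (simp add: ray_kernel_eq nmult_minus imult_minus)
  moreover have "kgen e {pprt ?x} \<inter> kgen e {pprt (- ?x)} = kgen e {0}"
    by (simp only: kgen_Int_kgen zero_le_pprt inf_pprt_pprt_minus)
  moreover have "kgen e {0} \<subseteq> {0}" by (simp add: kgen_subset_iff kernel_zero)
  ultimately show ?thesis unfolding ray_kernel_eq by blast
qed

text \<open>Over the common denominator \<open>g\<close> cancels from the sum of the two generating
  differences and leaves \<open>- (?a + ?b)\<close> units. The integer \<open>?a + ?b\<close> is
  negative, so this is at least one whole unit.\<close>

lemma ray_kernel_cover:
  assumes q: "0 < q" "0 < q'" and less: "of_int p / of_nat q + (of_int p' / of_nat q' :: real) < 0"
    and K: "w_kernel e K" "ray_kernel e g p q \<subseteq> K" "ray_kernel e (- g) p' q' \<subseteq> K"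
  shows "K = UNIV"
proof -
  interpret w_closed e K using K w_kernel_iff by blast
  let ?x = "nmult (q' * q) g" and ?a = "int q' * p" and ?b = "int q * p'"
  have "real_of_int (?a + ?b) < of_int 0"
    using less q by (simp add: field_simps)
  then have ab: "?a + ?b < 0" by (simp only: of_int_less_iff)
  have "ray_kernel e (- g) ?b (q' * q) = ray_kernel e (- g) p' q'"
    using ray_kernel_scale[OF q(1), of "- g" p' q'] by (simp only: mult.commute[of q' q])
  then have "pprt (- ?x - imult ?b e) \<in> K"
    using pprt_mem_ray_kernel[of "q' * q" "- g" ?b] K(3) by (auto simp: nmult_minus)
  moreover have "pprt (?x - imult ?a e) \<in> K"
    using pprt_mem_ray_kernel[of "q' * q" g ?a] K(2) q(2) by (auto simp: ray_kernel_scale)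
  ultimately have *: "pprt (?x - imult ?a e) + pprt (- ?x - imult ?b e) \<in> K" by (intro add_mem)
  have "e = imult 1 e" using imult_of_nat[of 1 e] by simp
  also have "\<dots> \<le> imult (- (?a + ?b)) e" using ab by (intro imult_mono unit_nonneg) simp
  also have "\<dots> = (?x - imult ?a e) + (- ?x - imult ?b e)"
    unfolding imult_minus imult_add by (simp add: algebra_simps)
  also have "\<dots> \<le> pprt (?x - imult ?a e) + pprt (- ?x - imult ?b e)"
    by (intro add_mono) (simp_all add: pprt_def)
  finally have "e \<in> K" using between_mem[OF *] unit_nonneg by blast
  with K(1) show ?thesis by (rule kernel_eq_UNIV)
qed

lemma rational_between:
  fixes a b :: real
  assumes "a < b"
  shows "\<exists>p q. 0 < q \<and> a < of_int p / of_nat q \<and> of_int p / of_nat q < b"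
proof -
  obtain x where "x \<in> \<rat>" "a < x" "x < b" using Rats_dense_in_real[OF assms] by blast
  then show ?thesis unfolding Rats_eq_int_div_nat by auto
qed

text \<open>The value that the Madden representation of \<open>g\<close> prescribes on
  \<open>{r<..}\<close> for an arbitrary real \<open>r\<close>.\<close>

definition upper :: "'a \<Rightarrow> real \<Rightarrow> 'a set" where
  "upper g r = kJoin e {ray_kernel e g p q | p q. 0 < q \<and> r < of_int p / of_nat q}"

lemma kernel_upper: "w_kernel e (upper g r)"
  unfolding upper_def by (rule kernel_kJoin)

lemma ray_kernel_subset_upper: "0 < q \<Longrightarrow> r < of_int p / of_nat q \<Longrightarrow> ray_kernel e g p q \<subseteq> upper g r"
  unfolding upper_def by (rule kJoin_upper) blast

lemma upper_subset_iff:
  "w_kernel e K \<Longrightarrow> upper g r \<subseteq> K \<longleftrightarrow>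
     (\<forall>p q. 0 < q \<longrightarrow> r < of_int p / of_nat q \<longrightarrow> ray_kernel e g p q \<subseteq> K)"
  unfolding upper_def by (subst kJoin_subset_iff) auto

lemma pprt_pprt_diff: "0 \<le> y \<Longrightarrow> pprt (pprt x - y) = pprt (x - y)"
  for x y :: 'a
  unfolding pprt_def diff_conv_add_uminus add_sup_distrib_right
  by (simp add: sup_assoc sup_absorb2)

text \<open>This reconciles the two prescriptions at a rational endpoint. Subtracting
  \<open>e\<close> from \<open>n\<close> times the generator moves the endpoint to
  \<open>(n p + 1) / (n q)\<close>, which is strictly larger than \<open>p / q\<close>; the
  archimedean condition recovers the generator.\<close>

lemma upper_rat:
  assumes q: "0 < q"
  shows "upper g (of_int p / of_nat q) = ray_kernel e g p q"
proof
  let ?U = "upper g (of_int p / of_nat q)"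
  show "?U \<subseteq> ray_kernel e g p q"
    unfolding upper_subset_iff[OF kernel_ray_kernel]
    by (intro allI impI ray_kernel_antimono q less_imp_le)
  interpret w_closed e ?U using kernel_upper w_kernel_iff by blast
  let ?x = "nmult q g - imult p e"
  have "pprt ?x \<in> ?U"
  proof (rule arch_mem[where y = e])
    fix n
    show "pprt (nmult n (pprt ?x) - e) \<in> ?U"
    proof (cases "n = 0")
      case True
      then show ?thesis using unit_nonneg by (simp add: zero_mem)
    next
      case False
      have "imult (int n * p + 1) e = nmult n (imult p e) + e"
        using imult_of_nat[of 1 e] by (simp only: imult_add imult_mult) simp
      then have "pprt (nmult n (pprt ?x) - e) = pprt (nmult (n * q) g - imult (int n * p + 1) e)"
        by (simp add: pprt_nmult[symmetric] pprt_pprt_diff unit_nonneg nmult_diff_right nmult_mult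
          diff_diff_add)
      also have "\<dots> \<in> ray_kernel e g (int n * p + 1) (n * q)" by (rule pprt_mem_ray_kernel)
      also have "\<dots> \<subseteq> ?U"
        using False q by (intro ray_kernel_subset_upper) (simp_all add: field_simps)
      finally show ?thesis .
    qed
  qed simp
  then show "ray_kernel e g p q \<subseteq> ?U"
    unfolding ray_kernel_eq by (simp add: kgen_subset_iff kernel_upper)
qed

lemma upper_disjoint:
  assumes "0 \<le> r + s"
  shows "upper g r \<inter> upper (- g) s \<subseteq> {0}"
  unfolding upper_def
proof (rule kJoin_Int_kJoin_subset[OF kernel_zero], goal_cases)
  case (3 X Y)
  then obtain p q p' q' where "X = ray_kernel e g p q" "0 < q" "r < of_int p / of_nat q"
    "Y = ray_kernel e (- g) p' q'" "0 < q'" "s < of_int p' / of_nat q'"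
    by blast
  with assms show ?case using ray_kernel_disjoint[of q q' p p' g] by simp
qed (auto simp: kernel_ray_kernel)

lemma upper_cover:
  assumes "r + s < 0"
  shows "kJoin e {upper g r, upper (- g) s} = UNIV"
proof -
  \<comment> \<open>The bounds \<open>(r - s) / 2\<close> and \<open>(s - r) / 2\<close> lie above
    \<open>r\<close> and \<open>s\<close> and add up to zero, so the rationals found below them have
    a negative sum.\<close>
  obtain p q where pq: "0 < q" "r < of_int p / of_nat q" "of_int p / of_nat q < (r - s) / 2"
    using rational_between[of r "(r - s) / 2"] assms by auto
  obtain p' q' where pq': "0 < q'" "s < of_int p' / of_nat q'" "of_int p' / of_nat q' < (s - r) / 2"
    using rational_between[of s "(s - r) / 2"] assms by auto
  have "of_int p / of_nat q + of_int p' / of_nat q' < (r - s) / 2 + (s - r) / 2"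
    using pq(3) pq'(3) by (rule add_strict_mono)
  then have *: "of_int p / of_nat q + (of_int p' / of_nat q' :: real) < 0" by (simp add: field_simps)
  show ?thesis
  proof (rule ray_kernel_cover[OF pq(1) pq'(1) * kernel_kJoin])
    show "ray_kernel e g p q \<subseteq> kJoin e {upper g r, upper (- g) s}"
      using ray_kernel_subset_upper[OF pq(1,2)] kJoin_upper[of "upper g r"] by blast
    show "ray_kernel e (- g) p' q' \<subseteq> kJoin e {upper g r, upper (- g) s}"
      using ray_kernel_subset_upper[OF pq'(1,2)] kJoin_upper[of "upper (- g) s"] by blast
  qed
qed

lemma upper_eq_kJoin: "upper g r = kJoin e (upper g ` {r<..})"
proof
  show "upper g r \<subseteq> kJoin e (upper g ` {r<..})"
    unfolding upper_subset_iff[OF kernel_kJoin]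
    by (intro allI impI kJoin_upper) (simp add: upper_rat[symmetric])
  show "kJoin e (upper g ` {r<..}) \<subseteq> upper g r"
    by (simp add: kJoin_subset_iff kernel_upper upper_subset_iff ray_kernel_subset_upper)
qed

text \<open>With the bound \<open>- g\<close>, the archimedean condition for \<open>e\<close> asks
  for the positive parts of \<open>nmult n e + g\<close>, which are the generators of the rays at
  \<open>- n\<close>.\<close>

lemma kJoin_range_upper: "kJoin e (range (upper g)) = UNIV"
proof (rule kernel_eq_UNIV[OF kernel_kJoin])
  interpret w_closed e "kJoin e (range (upper g))" using kernel_kJoin w_kernel_iff by blast
  show "e \<in> kJoin e (range (upper g))"
  proof (rule arch_mem[OF unit_nonneg, where y = "- g"])
    fix n
    have "pprt (nmult n e - - g) = pprt (nmult 1 g - imult (- int n) e)"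
      by (simp add: imult_minus imult_of_nat add.commute)
    also have "\<dots> \<in> ray_kernel e g (- int n) 1" by (rule pprt_mem_ray_kernel)
    also have "\<dots> = upper g (of_int (- int n) / of_nat 1)" by (rule upper_rat[symmetric]) simp
    also have "\<dots> \<subseteq> kJoin e (range (upper g))" by (rule kJoin_upper) blast
    finally show "pprt (nmult n e - - g) \<in> kJoin e (range (upper g))" .
  qed
qed

section \<open>Frame maps\<close>

lemma open_real_interval:
  fixes x :: real
  assumes "open U" "x \<in> U"
  shows "\<exists>d>0. {x - d<..<x + d} \<subseteq> U"
proof -
  obtain d where "d > 0" "\<And>y. dist y x < d \<Longrightarrow> y \<in> U"
    using assms open_dist by metis
  then show ?thesis by (intro exI[of _ d]) (auto simp: dist_real_def)
qed

lemma kJoin_empty: "kJoin e {} = {0}"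
  using kJoin_subset_iff[OF kernel_zero, of "{}"] w_closed.zero_mem kernel_kJoin w_kernel_iff by blast

lemma RL_iff:
  "f \<in> RL e \<longleftrightarrow> (\<forall>U. open U \<longrightarrow> w_kernel e (f U)) \<and> (\<forall>U. \<not> open U \<longrightarrow> f U = undefined) \<and>
     f UNIV = UNIV \<and> (\<forall>U V. open U \<longrightarrow> open V \<longrightarrow> f (U \<inter> V) = f U \<inter> f V) \<and>
     (\<forall>\<U>. (\<forall>U\<in>\<U>. open U) \<longrightarrow> f (\<Union>\<U>) = kJoin e (f ` \<U>))"
  unfolding RL_def madden_frame_def PiE_iff extensional_def
  by (simp only: ball_simps mem_Collect_eq conj_assoc)

context
  fixes f assumes f: "f \<in> RL e"
begin

lemmas RL_kernel = f[unfolded RL_iff, THEN conjunct1, rule_format]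
  and RL_extensional = f[unfolded RL_iff, THEN conjunct2, THEN conjunct1, rule_format]
  and RL_UNIV = f[unfolded RL_iff, THEN conjunct2, THEN conjunct2, THEN conjunct1]
  and RL_Int = f[unfolded RL_iff, THEN conjunct2, THEN conjunct2, THEN conjunct2, THEN conjunct1, rule_format]
  and RL_Union = f[unfolded RL_iff, THEN conjunct2, THEN conjunct2, THEN conjunct2, THEN conjunct2, rule_format]

lemma RL_mono: "open U \<Longrightarrow> open V \<Longrightarrow> U \<subseteq> V \<Longrightarrow> f U \<subseteq> f V"
  using RL_Int[of U V] by (simp add: inf_absorb1) blast

lemma RL_empty: "f {} = {0}"
  using RL_Union[of "{}"] by (simp add: kJoin_empty)

end

lemma RL_I:
  assumes "\<And>U. open U \<Longrightarrow> w_kernel e (f U)" "f UNIV = UNIV"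
    and "\<And>U V. open U \<Longrightarrow> open V \<Longrightarrow> f (U \<inter> V) = f U \<inter> f V"
    and "\<And>\<U>. (\<And>U. U \<in> \<U> \<Longrightarrow> open U) \<Longrightarrow> f (\<Union>\<U>) = kJoin e (f ` \<U>)"
  shows "restrict f {U. open U} \<in> RL e"
proof -
  have "restrict f {U. open U} ` \<U> = f ` \<U>" if "\<forall>U\<in>\<U>. open U" for \<U>
    using that by (intro image_cong) auto
  with assms show ?thesis by (simp add: RL_iff open_Union open_Int)
qed

text \<open>Lower rays are recovered from upper ones up to a gap: for \<open>s < t\<close> the
  values of \<open>f'\<close> on \<open>{..<t}\<close> and \<open>{s<..}\<close> cover the top, and
  the second, shared with \<open>f\<close>, is disjoint from \<open>f {..<s}\<close>. Writing
  \<open>U\<close> as a union of intervals with room to their right absorbs the gap.\<close>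

lemma RL_le_of_rays:
  assumes f: "f \<in> RL e" and f': "f' \<in> RL e" and U: "open U"
    and rays: "\<And>p q. 0 < q \<Longrightarrow> f {of_int p / of_nat q<..} = f' {of_int p / of_nat q<..}"
  shows "f U \<subseteq> f' U"
proof -
  have up: "f {r<..} = f' {r<..}" for r
  proof -
    let ?\<U> = "{{of_int p / of_nat q<..} | p q. 0 < q \<and> r < of_int p / of_nat q}"
    have "{r<..} = \<Union>?\<U>"
    proof (intro equalityI subsetI)
      fix x assume "x \<in> {r<..}"
      then show "x \<in> \<Union>?\<U>" using rational_between[of r x] by auto
    qed auto
    then have *: "k {r<..} = kJoin e (k ` ?\<U>)" if "k \<in> RL e" for k
      using RL_Union[OF that, of ?\<U>] by fastforce
    have "f ` ?\<U> = f' ` ?\<U>" by (intro image_cong) (auto simp: rays)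
    then show ?thesis unfolding *[OF f] *[OF f'] by simp
  qed
  have down: "f {..<s} \<subseteq> f' {..<t}" if "s < t" for s t
  proof (rule kernel_subset_of_cover)
    show "kJoin e {f' {..<t}, f' {s<..}} = UNIV"
    proof -
      have "\<Union>{{..<t}, {s<..}} = UNIV" using that by auto
      moreover have "f' (\<Union>{{..<t}, {s<..}}) = kJoin e (f' ` {{..<t}, {s<..}})"
        by (rule RL_Union[OF f']) auto
      ultimately show ?thesis by (simp add: RL_UNIV[OF f'])
    qed
    have "f' {s<..} \<inter> f {..<s} = f {s<..} \<inter> f {..<s}" by (simp only: up)
    also have "\<dots> = f ({s<..} \<inter> {..<s})" by (rule RL_Int[OF f, symmetric]) auto
    also have "{s<..} \<inter> {..<s} = {}" by auto
    finally have "f' {s<..} \<inter> f {..<s} \<subseteq> {0}" by (simp add: RL_empty[OF f])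
    moreover have "0 \<in> f' {..<t}"
      using RL_kernel[OF f', of "{..<t}"] w_closed.zero_mem w_kernel_iff by auto
    ultimately show "X \<inter> f {..<s} \<subseteq> f' {..<t}" if "X \<in> {f' {..<t}, f' {s<..}}" for X
      using that by auto
  qed (use RL_kernel[OF f] RL_kernel[OF f'] in auto)
  let ?\<U> = "{{a<..<b} | a b. \<exists>c>b. {a<..<c} \<subseteq> U}"
  have "U = \<Union>?\<U>"
  proof (intro equalityI subsetI)
    fix x assume "x \<in> U"
    then obtain d where "d > 0" "{x - d<..<x + d} \<subseteq> U" using open_real_interval U by blast
    then have "{x - d<..<x + d / 2} \<in> ?\<U>" "x \<in> {x - d<..<x + d / 2}"
      by (simp_all, intro exI[of _ "x - d"] exI[of _ "x + d / 2"] conjI refl exI[of _ "x + d"]) simp_all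
    then show "x \<in> \<Union>?\<U>" by (rule UnionI)
  qed fastforce
  then have "f U = kJoin e (f ` ?\<U>)" using RL_Union[OF f, of ?\<U>] by fastforce
  also have "\<dots> \<subseteq> f' U"
  proof (subst kJoin_subset_iff[OF RL_kernel[OF f' U]], clarify)
    fix a b c x assume c: "b < c" "{a<..<c} \<subseteq> U" and x: "x \<in> f {a<..<b}"
    have "f {a<..<b} = f {a<..} \<inter> f {..<b}"
      using RL_Int[OF f, of "{a<..}" "{..<b}"] by (simp add: greaterThanLessThan_eq)
    also have "\<dots> \<subseteq> f' {a<..} \<inter> f' {..<c}" using up down[OF c(1)] by blast
    also have "\<dots> = f' {a<..<c}"
      using RL_Int[OF f', of "{a<..}" "{..<c}"] by (simp add: greaterThanLessThan_eq)
    also have "\<dots> \<subseteq> f' U" using c(2) U by (intro RL_mono[OF f']) auto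
    finally show "x \<in> f' U" using x by blast
  qed
  finally show ?thesis .
qed

lemma RL_eqI:
  assumes "f \<in> RL e" "f' \<in> RL e"
    and "\<And>p q. 0 < q \<Longrightarrow> f {of_int p / of_nat q<..} = f' {of_int p / of_nat q<..}"
  shows "f = f'"
proof
  fix U
  show "f U = f' U"
  proof (cases "open U")
    case True
    show ?thesis
      using RL_le_of_rays[OF assms(1,2) True assms(3)]
        RL_le_of_rays[OF assms(2,1) True assms(3)[symmetric]] by blast
  qed (simp add: RL_extensional[OF assms(1)] RL_extensional[OF assms(2)])
qed

text \<open>The map \<open>f\<close> in the proof preserves unions because \<open>{a..b}\<close> is compact.\<close>

lemma RL_of_cut:
  assumes kernels: "\<And>r. w_kernel e (R r)" "\<And>r. w_kernel e (L r)"
    and disjoint: "\<And>r s. s \<le> r \<Longrightarrow> R r \<inter> L s \<subseteq> {0}"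
    and cover: "\<And>r s. r < s \<Longrightarrow> kJoin e {R r, L s} = UNIV"
    and R: "\<And>r. R r = kJoin e (R ` {r<..})" and L: "\<And>r. L r = kJoin e (L ` {..<r})"
    and top: "kJoin e (range R) = UNIV" "kJoin e (range L) = UNIV"
  shows "\<exists>f\<in>RL e. (\<forall>r. f {r<..} = R r) \<and> (\<forall>r. f {..<r} = L r)"
proof -
  \<comment> \<open>Here \<open>R a \<inter> L b\<close> stands for the open interval from
    \<open>a\<close> to \<open>b\<close>; asking that its closure lie in \<open>U\<close> makes
    compactness available. Pairs with \<open>b < a\<close> qualify for every \<open>U\<close> and
    contribute nothing, by \<open>disjoint\<close>.\<close>
  define f where "f U = kJoin e {R a \<inter> L b | a b. {a..b} \<subseteq> U}" for U
  have zero: "0 \<in> K" if "w_kernel e K" for K using that w_closed.zero_mem w_kernel_iff by blast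
  have ker_f: "w_kernel e (f U)" for U unfolding f_def by (rule kernel_kJoin)
  have f_upper: "R a \<inter> L b \<subseteq> f U" if "{a..b} \<subseteq> U" for a b U
    unfolding f_def by (rule kJoin_upper) (use that in blast)
  have f_least: "f U \<subseteq> K" if "w_kernel e K" "\<And>a b. {a..b} \<subseteq> U \<Longrightarrow> R a \<inter> L b \<subseteq> K" for U K
    unfolding f_def kJoin_subset_iff[OF that(1)] using that(2) by blast
  have R_mono: "R b \<subseteq> R a" if "a \<le> b" for a b
    using that kJoin_upper[of "R b" "R ` {a<..}"] unfolding R[of a, symmetric] by (cases "a = b") auto
  have L_mono: "L a \<subseteq> L b" if "a \<le> b" for a b
    using that kJoin_upper[of "L a" "L ` {..<b}"] unfolding L[of b, symmetric] by (cases "a = b") auto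
  have f_mono: "f U \<subseteq> f V" if "U \<subseteq> V" for U V
    using that by (intro f_least ker_f f_upper) blast
  have f_UNIV: "f UNIV = UNIV"
  proof -
    have "kJoin e (range R) \<inter> kJoin e (range L) \<subseteq> f UNIV"
    proof (rule kJoin_Int_kJoin_subset[OF ker_f])
      fix X Y assume "X \<in> range R" "Y \<in> range L"
      then show "X \<inter> Y \<subseteq> f UNIV" using f_upper[of _ _ UNIV] by force
    qed (auto simp: kernels)
    then show ?thesis by (auto simp: top)
  qed
  have f_Int: "f (U \<inter> V) = f U \<inter> f V" for U V
  proof
    show "f U \<inter> f V \<subseteq> f (U \<inter> V)"
    proof (subst (1 2) f_def, rule kJoin_Int_kJoin_subset[OF ker_f], goal_cases)
      case (3 X Y)
      then obtain a b c d where "{a..b} \<subseteq> U" "X = R a \<inter> L b" "{c..d} \<subseteq> V" "Y = R c \<inter> L d"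
        by blast
      moreover from this have "{max a c..min b d} \<subseteq> U \<inter> V" by auto
      ultimately show ?case using f_upper[of "max a c" "min b d" "U \<inter> V"]
        by (auto simp: max_def min_def split: if_splits)
    qed (auto simp: kernel_Int kernels)
  qed (auto intro: f_mono[THEN subsetD])
  have f_Union: "f (\<Union>\<U>) = kJoin e (f ` \<U>)" (is "_ = ?J") if op: "\<And>U. U \<in> \<U> \<Longrightarrow> open U" for \<U>
  proof
    show "?J \<subseteq> f (\<Union>\<U>)"
      unfolding kJoin_subset_iff[OF ker_f] by (auto intro: f_mono[THEN subsetD])
    show "f (\<Union>\<U>) \<subseteq> ?J"
    proof (rule f_least[OF kernel_kJoin])
      fix a b assume ab: "{a..b} \<subseteq> \<Union>\<U>"
      show "R a \<inter> L b \<subseteq> ?J"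
      proof (cases "a \<le> b")
        case True
        \<comment> \<open>Bisection stands in for finite subcovers. The enlargement by
          \<open>d\<close> is what makes the claim additive: adjacent intervals then overlap around
          their common endpoint \<open>b\<close>, where \<open>R (b - d)\<close> and
          \<open>L (b + d)\<close> cover the top.\<close>
        then have "\<exists>d>0. R (a - d) \<inter> L (b + d) \<subseteq> ?J"
        proof (induction rule: Bolzano)
          case (trans a b c)
          then obtain d1 d2 where d: "0 < d1" "R (a - d1) \<inter> L (b + d1) \<subseteq> ?J"
            "0 < d2" "R (b - d2) \<inter> L (c + d2) \<subseteq> ?J" by blast
          define d where "d = min d1 d2"
          have d': "d \<le> d1" "d \<le> d2" "0 < d" using d by (simp_all add: d_def)
          have "R (a - d) \<inter> L (c + d) \<subseteq> ?J"
          proof (rule kernel_subset_of_cover[OF kernel_kJoin _ _ cover[of "b - d" "b + d"]])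
            fix X assume "X \<in> {R (b - d), L (b + d)}"
            moreover have "R (b - d) \<subseteq> R (b - d2)" "R (a - d) \<subseteq> R (a - d1)"
              using d' by (auto intro!: R_mono)
            moreover have "L (c + d) \<subseteq> L (c + d2)" "L (b + d) \<subseteq> L (b + d1)"
              using d' by (auto intro!: L_mono)
            ultimately show "X \<inter> (R (a - d) \<inter> L (c + d)) \<subseteq> ?J" using d(2,4) by blast
          qed (use d' in \<open>auto simp: kernel_Int kernels\<close>)
          then show ?case using d' by blast
        next
          case (local x)
          then obtain U where U: "U \<in> \<U>" "x \<in> U" using ab by auto
          then obtain d where d: "d > 0" "{x - d<..<x + d} \<subseteq> U"
            using open_real_interval op by blast
          \<comment> \<open>One third of \<open>d\<close> bounds the length of the interval around
            \<open>x\<close> and another third its enlargement, so the closed interval stays inside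
            the \<open>d\<close>-neighbourhood.\<close>
          have *: "R (c - d / 3) \<inter> L (c' + d / 3) \<subseteq> ?J"
            if "c \<le> x" "x \<le> c'" "c' - c < d / 3" for c c'
          proof -
            have "{c - d / 3..c' + d / 3} \<subseteq> U"
              using d that by (intro order_trans[OF _ d(2)] subsetI) auto
            then have "R (c - d / 3) \<inter> L (c' + d / 3) \<subseteq> f U" by (rule f_upper)
            also have "\<dots> \<subseteq> ?J" using U by (intro kJoin_upper) blast
            finally show ?thesis .
          qed
          show ?case
            by (intro exI[of _ "d / 3"] conjI allI impI) (simp_all add: d(1) *)
        qed
        then obtain d where "d > 0" "R (a - d) \<inter> L (b + d) \<subseteq> ?J" by blast
        then show ?thesis using R_mono[of "a - d" a] L_mono[of b "b + d"] by auto
      next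
        case False
        then show ?thesis using disjoint[of b a] zero[OF kernel_kJoin] by auto
      qed
    qed
  qed
  have "f {r<..} = R r" for r
  proof
    show "f {r<..} \<subseteq> R r"
    proof (rule f_least[OF kernels(1)])
      fix a b assume "{a..b} \<subseteq> {r<..}"
      then have "a \<le> b \<Longrightarrow> r < a" by (auto dest: subsetD[of _ _ a])
      then show "R a \<inter> L b \<subseteq> R r"
        using disjoint[of b a] zero[OF kernels(1)[of r]] R_mono[of r a]
        by (cases "a \<le> b") auto
    qed
    have "kJoin e (R ` {r<..}) \<inter> kJoin e (range L) \<subseteq> f {r<..}"
    proof (rule kJoin_Int_kJoin_subset[OF ker_f])
      fix X Y assume "X \<in> R ` {r<..}" "Y \<in> range L"
      then show "X \<inter> Y \<subseteq> f {r<..}" by (auto intro!: f_upper[THEN subsetD])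
    qed (auto simp: kernels)
    then show "R r \<subseteq> f {r<..}" by (simp add: top R[symmetric])
  qed
  moreover have "f {..<r} = L r" for r
  proof
    show "f {..<r} \<subseteq> L r"
    proof (rule f_least[OF kernels(2)])
      fix a b assume "{a..b} \<subseteq> {..<r}"
      then have "a \<le> b \<Longrightarrow> b < r" by (auto dest: subsetD[of _ _ b])
      then show "R a \<inter> L b \<subseteq> L r"
        using disjoint[of b a] zero[OF kernels(2)[of r]] L_mono[of b r]
        by (cases "a \<le> b") auto
    qed
    have "kJoin e (range R) \<inter> kJoin e (L ` {..<r}) \<subseteq> f {..<r}"
    proof (rule kJoin_Int_kJoin_subset[OF ker_f])
      fix X Y assume "X \<in> range R" "Y \<in> L ` {..<r}"
      then show "X \<inter> Y \<subseteq> f {..<r}" by (auto intro!: f_upper[THEN subsetD])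
    qed (auto simp: kernels)
    then show "L r \<subseteq> f {..<r}" by (simp add: top L[symmetric])
  qed
  moreover have "restrict f {U. open U} \<in> RL e"
    by (intro RL_I ker_f f_UNIV f_Int f_Union)
  ultimately show ?thesis by (intro bexI[of _ "restrict f {U. open U}"]) auto
qed

section \<open>The Madden representation and truncation\<close>

text \<open>The lower half of the cut comes from \<open>- g\<close>, since \<open>g\<close> is below
  \<open>r\<close> where \<open>- g\<close> is above \<open>- r\<close>.\<close>

lemma RL_of_upper: "\<exists>f\<in>RL e. (\<forall>r. f {r<..} = upper g r) \<and> (\<forall>r. f {..<r} = upper (- g) (- r))"
proof (rule RL_of_cut)
  show "upper g r \<inter> upper (- g) (- s) \<subseteq> {0}" if "s \<le> r" for r s
    using that by (intro upper_disjoint) simp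
  show "kJoin e {upper g r, upper (- g) (- s)} = UNIV" if "r < s" for r s
    using that by (intro upper_cover) simp
  have img: "(\<lambda>r. upper (- g) (- r)) ` A = upper (- g) ` (uminus ` A)" for A
    by (simp add: image_image)
  have "uminus ` {..<r} = {- r<..}" for r :: real
    by (metis image_uminus_lessThan)
  then show "upper (- g) (- r) = kJoin e ((\<lambda>r. upper (- g) (- r)) ` {..<r})" for r
    unfolding img by (metis upper_eq_kJoin)
  show "kJoin e (range (\<lambda>r. upper (- g) (- r))) = UNIV"
    unfolding img by (simp add: kJoin_range_upper)
qed (fact kernel_upper upper_eq_kJoin kJoin_range_upper)+

text \<open>Rational rays determine a frame map, so the clause of \<open>madden_rep\<close> on
  arbitrary real rays follows by comparison with the map built from the cut.\<close>

lemma madden_rep_eqI: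
  assumes f: "f \<in> RL e"
    and rays: "\<And>p q. 0 < q \<Longrightarrow> f {of_int p / of_nat q<..} = ray_kernel e g p q"
  shows "madden_rep e g = f"
proof -
  obtain f0 where f0: "f0 \<in> RL e" "\<And>r. f0 {r<..} = upper g r"
    using RL_of_upper[of g] by meson
  have "f = f0"
  proof (rule RL_eqI[OF f f0(1)])
    fix p :: int and q :: nat assume "0 < q"
    then show "f {of_int p / of_nat q<..} = f0 {of_int p / of_nat q<..}"
      unfolding f0(2) by (simp only: rays upper_rat)
  qed
  have r: "f {r<..} = upper g r" for r unfolding \<open>f = f0\<close> by (rule f0(2))
  show ?thesis unfolding madden_rep_def
  proof (rule the_equality)
    show "f \<in> RL e \<and> (\<forall>p q. 0 < q \<longrightarrow> f {of_int p / of_nat q<..} = ray_kernel e g p q) \<and>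
     (\<forall>r. f {r<..} = kJoin e {ray_kernel e g p q | p q. 0 < q \<and> r < of_int p / of_nat q})"
      using f rays r unfolding upper_def by simp
  next
    fix f'
    assume *: "f' \<in> RL e \<and> (\<forall>p q. 0 < q \<longrightarrow> f' {of_int p / of_nat q<..} = ray_kernel e g p q) \<and>
     (\<forall>r. f' {r<..} = kJoin e {ray_kernel e g p q | p q. 0 < q \<and> r < of_int p / of_nat q})"
    show "f' = f"
      by (rule RL_eqI[OF *[THEN conjunct1] f])
        (simp only: rays *[THEN conjunct2, THEN conjunct1, rule_format])
  qed
qed

lemma madden_rep_mem_RL: "madden_rep e g \<in> RL e" (is ?A)
  and madden_rep_greaterThan: "madden_rep e g {r<..} = upper g r" (is ?B)
  and madden_rep_lessThan: "madden_rep e g {..<r} = upper (- g) (- r)" (is ?C)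
proof -
  obtain f where f: "f \<in> RL e" "\<And>r. f {r<..} = upper g r" "\<And>r. f {..<r} = upper (- g) (- r)"
    using RL_of_upper[of g] by meson
  have "madden_rep e g = f"
    by (rule madden_rep_eqI[OF f(1)]) (simp only: f(2) upper_rat)
  with f show ?A ?B ?C by simp_all
qed

lemma madden_rep_ray:
  "0 < q \<Longrightarrow> madden_rep e g {of_int p / of_nat q<..} = ray_kernel e g p q"
  by (simp only: madden_rep_greaterThan upper_rat)

section \<open>Truncation by a constant, in the frame and in the group\<close>

definition trunc :: "real \<Rightarrow> (real set \<Rightarrow> 'a set) \<Rightarrow> real set \<Rightarrow> 'a set" where
  "trunc c f = (\<lambda>U\<in>{U. open U}. f ((\<lambda>x. min x c) -` U))"

lemma open_min_vimage: "open U \<Longrightarrow> open ((\<lambda>x. min x c) -` U)" for c :: real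
  by (intro open_vimage continuous_intros)

lemma trunc_apply: "open U \<Longrightarrow> trunc c f U = f ((\<lambda>x. min x c) -` U)"
  by (simp add: trunc_def)

lemma trunc_mem_RL:
  assumes f: "f \<in> RL e"
  shows "trunc c f \<in> RL e"
  unfolding trunc_def
proof (rule RL_I)
  fix \<U> :: "real set set" assume "\<And>U. U \<in> \<U> \<Longrightarrow> open U"
  then have "f (\<Union>((-`) (\<lambda>x. min x c) ` \<U>)) = kJoin e (f ` (-`) (\<lambda>x. min x c) ` \<U>)"
    by (intro RL_Union[OF f]) (auto simp: open_min_vimage)
  then show "f ((\<lambda>x. min x c) -` \<Union>\<U>) = kJoin e ((\<lambda>U. f ((\<lambda>x. min x c) -` U)) ` \<U>)"
    by (simp only: vimage_Union image_image)
qed (simp_all add: RL_kernel[OF f] RL_UNIV[OF f] RL_Int[OF f] open_min_vimage)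

text \<open>The constant is top or bottom on \<open>W\<close> according to whether \<open>c\<close>
  lies in \<open>W\<close>, so only pairs with \<open>c\<close> in \<open>W\<close> contribute.
  Their sets \<open>V\<close> cover the preimage of \<open>U\<close> because \<open>min\<close> is
  continuous at each \<open>(x, c)\<close>.\<close>

lemma RL_meet_const:
  assumes h: "h \<in> RL e"
  shows "RL_meet e h (RL_const e c) = trunc c h"
proof
  fix U
  show "RL_meet e h (RL_const e c) U = trunc c h U"
  proof (cases "open U")
    case U: True
    let ?T = "(\<lambda>x. min x c) -` U"
    let ?adm = "\<lambda>V W. open V \<and> open W \<and> (\<forall>x\<in>V. \<forall>y\<in>W. min x y \<in> U)"
    let ?J = "kJoin e {h V \<inter> RL_const e c W | V W. ?adm V W}"
    have "?J = h ?T"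
    proof
      show "?J \<subseteq> h ?T"
      proof (subst kJoin_subset_iff[OF RL_kernel[OF h open_min_vimage[OF U]]], clarify)
        fix V W x assume V: "open V" and W: "open W" and VW: "\<forall>x\<in>V. \<forall>y\<in>W. min x y \<in> U"
          and x: "x \<in> h V" "x \<in> RL_const e c W"
        show "x \<in> h ?T"
        proof (cases "c \<in> W")
          case True
          then have "V \<subseteq> ?T" using VW by auto
          then show ?thesis using RL_mono[OF h V open_min_vimage[OF U]] x by blast
        next
          case False
          then have "x = 0" using x W by (simp add: RL_const_def kJoin_empty)
          then show ?thesis
            using RL_kernel[OF h open_min_vimage[OF U]] w_closed.zero_mem w_kernel_iff by blast
        qed
      qed
      let ?\<V> = "{V. \<exists>W. c \<in> W \<and> ?adm V W}"
      have "?T \<subseteq> \<Union>?\<V>"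
      proof
        fix x assume "x \<in> ?T"
        then obtain d where d: "d > 0" "{min x c - d<..<min x c + d} \<subseteq> U"
          using open_real_interval U by blast
        have "min x' c' \<in> U" if "x' \<in> {x - d<..<x + d}" "c' \<in> {c - d<..<c + d}" for x' c'
          using that by (intro subsetD[OF d(2)]) (auto simp: min_def)
        then have "?adm {x - d<..<x + d} {c - d<..<c + d}" by simp
        moreover have "c \<in> {c - d<..<c + d}" "x \<in> {x - d<..<x + d}" using d(1) by simp_all
        ultimately show "x \<in> \<Union>?\<V>" by blast
      qed
      then have "h ?T \<subseteq> h (\<Union>?\<V>)"
        by (intro RL_mono[OF h] open_min_vimage[OF U] open_Union) auto
      also have "\<dots> = kJoin e (h ` ?\<V>)" by (intro RL_Union[OF h]) blast
      also have "\<dots> \<subseteq> ?J"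
      proof (subst kJoin_subset_iff[OF kernel_kJoin], clarify)
        fix V W x assume W: "c \<in> W" "open W" and V: "open V" "\<forall>x\<in>V. \<forall>y\<in>W. min x y \<in> U"
          and x: "x \<in> h V"
        have "h V \<inter> RL_const e c W \<subseteq> ?J" using V W by (intro kJoin_upper) blast
        moreover have "RL_const e c W = UNIV" using W by (simp add: RL_const_def)
        ultimately show "x \<in> ?J" using x by blast
      qed
      finally show "h ?T \<subseteq> ?J" .
    qed
    then show ?thesis using U by (simp add: RL_meet_def RL_lift2_def trunc_def)
  qed (simp add: RL_meet_def RL_lift2_def trunc_def)
qed

lemma nmult_inf: "nmult n (inf x y) = inf (nmult n x) (nmult n y)" for x y :: 'a
proof -
  have "nmult n x - nmult n (inf x y) = nmult n (pprt (x - y))"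
    by (simp only: nmult_diff_right[symmetric] diff_inf_eq_pprt)
  also have "\<dots> = nmult n x - inf (nmult n x) (nmult n y)"
    by (simp only: pprt_nmult[symmetric] nmult_diff_right diff_inf_eq_pprt)
  finally show ?thesis by (simp only: diff_left_imp_eq)
qed

text \<open>The ray kernel of the meet splits into that of \<open>a\<close> and the kernel generated
  by the positive part of \<open>q n - p\<close> units. As \<open>q n - p\<close> is an integer, the
  latter is everything if \<open>p / q < n\<close> and zero otherwise.\<close>

lemma madden_rep_inf_nmult: "madden_rep e (inf a (nmult n e)) = trunc (real n) (madden_rep e a)"
proof (rule madden_rep_eqI[OF trunc_mem_RL[OF madden_rep_mem_RL]])
  fix p :: int and q :: nat assume q: "0 < q"
  let ?r = "of_int p / of_nat q :: real" and ?y = "imult (int q * int n - p) e"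
  have "nmult q (inf a (nmult n e)) - imult p e
      = inf (nmult q a - imult p e) (imult (int q * int n) e - imult p e)"
    by (simp only: nmult_inf imult_mult imult_of_nat diff_conv_add_uminus add_inf_distrib_right)
  also have "imult (int q * int n) e - imult p e = ?y"
    using imult_add[of "int q * int n" "- p" e] by (simp add: imult_minus)
  finally have k: "ray_kernel e (inf a (nmult n e)) p q = ray_kernel e a p q \<inter> kgen e {pprt ?y}"
    unfolding ray_kernel_eq by (simp only: pprt_inf kgen_Int_kgen zero_le_pprt)
  have "trunc (real n) (madden_rep e a) {?r<..} = madden_rep e a ((\<lambda>x. min x (real n)) -` {?r<..})"
    by (simp add: trunc_apply)
  also have "\<dots> = ray_kernel e (inf a (nmult n e)) p q"
  proof (cases "?r < real n")
    case True
    then have "real_of_int p < real_of_int (int q * int n)" using q by (simp add: field_simps)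
    then have "imult 1 e \<le> ?y" by (intro imult_mono unit_nonneg) linarith
    then have "e \<le> pprt ?y" using imult_of_nat[of 1 e] by (simp add: pprt_def le_supI1)
    then have "e \<in> kgen e {pprt ?y}"
      using w_closed.between_mem[of e "kgen e {pprt ?y}" "pprt ?y" e] kgen_superset[of "{pprt ?y}"]
        kernel_kgen w_kernel_iff unit_nonneg by blast
    then have "kgen e {pprt ?y} = UNIV" by (intro kernel_eq_UNIV kernel_kgen)
    moreover have "(\<lambda>x. min x (real n)) -` {?r<..} = {?r<..}" using True by auto
    ultimately show ?thesis by (simp only: k madden_rep_ray q Int_UNIV_right)
  next
    case False
    then have "real_of_int (int q * int n) \<le> real_of_int p" using q by (simp add: field_simps)
    then have "?y \<le> imult 0 e" by (intro imult_mono unit_nonneg) linarith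
    then have "pprt ?y = 0" by (simp add: imult_def)
    then have "kgen e {pprt ?y} = {0}"
      using kgen_subset_iff[OF kernel_zero, of "{0}"] kgen_superset[of "{0}"] by auto
    moreover have "0 \<in> ray_kernel e a p q"
      using kernel_ray_kernel w_closed.zero_mem w_kernel_iff by blast
    moreover have "(\<lambda>x. min x (real n)) -` {?r<..} = {}" using False by auto
    ultimately show ?thesis by (simp add: k RL_empty[OF madden_rep_mem_RL])
  qed
  finally show "trunc (real n) (madden_rep e a) {?r<..} = ray_kernel e (inf a (nmult n e)) p q" .
qed

text \<open>It suffices that \<open>q\<close> times \<open>pprt (a - b)\<close> stays below
  \<open>nmult 2 e\<close> for every \<open>q\<close>. This is tested where \<open>a\<close> lies
  between \<open>p / q\<close> and \<open>(p + 2) / q\<close>: there \<open>b\<close> exceeds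
  \<open>p / q\<close> by hypothesis, so \<open>q (a - b)\<close> cannot exceed two units. The width
  is two because open intervals of width \<open>1 / q\<close> with these endpoints would miss the
  endpoints themselves.\<close>

lemma le_of_ray_kernels:
  assumes le: "\<And>p q. 0 < q \<Longrightarrow> ray_kernel e a p q \<subseteq> ray_kernel e b p q"
  shows "a \<le> b"
proof -
  interpret w_closed e "{0}" using kernel_zero w_kernel_iff by blast
  have "pprt (nmult q (pprt (a - b)) - nmult 2 e) = 0" for q
  proof (cases "q = 0")
    case True
    then show ?thesis using unit_nonneg by (simp add: nmult_nonneg)
  next
    case False
    then have q: "0 < q" by simp
    let ?u = "nmult q a" and ?v = "nmult q b"
    let ?w = "pprt (?u - ?v - nmult 2 e)"
    let ?I = "\<lambda>p. {of_int p / of_nat q<..<of_int (p + 2) / of_nat q} :: real set"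
    let ?f = "madden_rep e a"
    have "x \<in> (\<Union>p. ?I p)" for x :: real
    proof -
      have "x \<in> ?I (\<lceil>x * real q\<rceil> - 1)"
        using q by (simp add: divide_less_eq less_divide_eq) linarith
      then show ?thesis by blast
    qed
    then have "(\<Union>p. ?I p) = UNIV" by blast
    moreover have "?f (\<Union>p. ?I p) = kJoin e (?f ` range ?I)"
      by (intro RL_Union[OF madden_rep_mem_RL]) auto
    ultimately have cover: "kJoin e (?f ` range ?I) = UNIV"
      by (simp add: RL_UNIV[OF madden_rep_mem_RL])
    have "kgen e {?w} \<subseteq> {0}"
    proof (rule kernel_subset_of_cover[OF kernel_zero _ kernel_kgen cover])
      fix X assume "X \<in> ?f ` range ?I"
      then obtain p where X: "X = ?f (?I p)" by blast
      then show "w_kernel e X" by (simp add: RL_kernel[OF madden_rep_mem_RL])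
      have "?I p = {of_int p / of_nat q<..} \<inter> {..<of_int (p + 2) / of_nat q}" by auto
      then have "X = ?f {of_int p / of_nat q<..} \<inter> ?f {..<of_int (p + 2) / of_nat q}"
        unfolding X by (simp only: RL_Int[OF madden_rep_mem_RL] open_greaterThan open_lessThan)
      also have "?f {of_int p / of_nat q<..} = ray_kernel e a p q" using q by (rule madden_rep_ray)
      also have "?f {..<of_int (p + 2) / of_nat q} = ray_kernel e (- a) (- (p + 2)) q"
        unfolding madden_rep_lessThan upper_rat[OF q, symmetric] by (simp add: minus_divide_left)
      finally have X': "X = ray_kernel e a p q \<inter> ray_kernel e (- a) (- (p + 2)) q" .
      have "imult (- (p + 2)) e = - imult p e - nmult 2 e"
        using imult_of_nat[of 2 e] by (simp only: imult_minus imult_add) simp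
      \<comment> \<open>The terms in \<open>a\<close> cancel. Where \<open>a\<close> is below
        \<open>(p + 2) / q\<close> and the excess \<open>?w\<close> is positive, \<open>b\<close>
        would be below \<open>p / q\<close>.\<close>
      then have "(nmult q (- a) - imult (- (p + 2)) e) + (?u - ?v - nmult 2 e)
          = nmult q (- b) - imult (- p) e"
        by (simp add: nmult_minus imult_minus)
      then have "inf (pprt (nmult q (- a) - imult (- (p + 2)) e)) ?w
          \<le> pprt (nmult q (- b) - imult (- p) e)"
        using inf_pprt_le[of "nmult q (- a) - imult (- (p + 2)) e" "?u - ?v - nmult 2 e"] by simp
      then have "ray_kernel e (- a) (- (p + 2)) q \<inter> kgen e {?w} \<subseteq> ray_kernel e (- b) (- p) q"
        unfolding ray_kernel_eq by (simp only: kgen_Int_kgen zero_le_pprt) (intro kgen_mono_le; simp)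
      then have "X \<inter> kgen e {?w} \<subseteq> ray_kernel e b p q \<inter> ray_kernel e (- b) (- p) q"
        unfolding X' using le[OF q] by blast
      also have "\<dots> \<subseteq> {0}" using q by (intro ray_kernel_disjoint) simp_all
      finally show "X \<inter> kgen e {?w} \<subseteq> {0}" .
    qed
    then have "?w = 0" using kgen_superset[of "{?w}"] by blast
    then show ?thesis
      by (simp add: pprt_nmult[symmetric] pprt_pprt_diff nmult_nonneg unit_nonneg nmult_diff_right)
  qed
  then have "pprt (a - b) \<in> {0}"
    by (intro arch_mem[of "pprt (a - b)" "nmult 2 e"]) simp_all
  then show ?thesis by (simp add: le_zero_iff_zero_pprt[symmetric])
qed

lemma madden_rep_inject: "madden_rep e a = madden_rep e b \<Longrightarrow> a = b"
  by (intro antisym le_of_ray_kernels) (simp_all add: madden_rep_ray[symmetric])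

section \<open>Sequences of truncates\<close>

lemma trunc_trunc: "trunc c (trunc d f) = trunc (min c d) f"
proof
  fix U
  have "(\<lambda>x. min x d) -` (\<lambda>x. min x c) -` U = (\<lambda>x. min x (min c d)) -` U"
    by (simp add: vimage_def min.assoc min.commute min.left_commute)
  then show "trunc c (trunc d f) U = trunc (min c d) f U"
    by (cases "open U") (simp_all add: trunc_def open_min_vimage)
qed

lemma truncates_inf:
  assumes trunc: "\<And>n. n \<ge> 1 \<Longrightarrow> madden_rep e (g n) = trunc (real n) h" and n: "n \<ge> 1"
  shows "inf (g (n + 1)) (nmult n e) = g n"
proof (rule madden_rep_inject)
  have "madden_rep e (inf (g (n + 1)) (nmult n e)) = trunc (real n) (trunc (real (n + 1)) h)"
    using trunc[of "n + 1"] by (simp only: madden_rep_inf_nmult)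
  also have "\<dots> = madden_rep e (g n)" by (simp add: trunc_trunc trunc[OF n])
  finally show "madden_rep e (inf (g (n + 1)) (nmult n e)) = madden_rep e (g n)" .
qed

lemma truncates_cover:
  assumes h: "h \<in> RL e" and trunc: "\<And>n. n \<ge> 1 \<Longrightarrow> madden_rep e (g n) = trunc (real n) h"
  shows "kJoin e {madden_rep e (g n) {..<real n} | n. n \<ge> 1} = UNIV"
proof -
  let ?\<U> = "(\<lambda>n. {..<real n}) ` {1..}"
  have "madden_rep e (g n) {..<real n} = h {..<real n}" if "n \<ge> 1" for n
  proof -
    have "(\<lambda>x. min x (real n)) -` {..<real n} = {..<real n}" by auto
    then show ?thesis by (simp add: trunc[OF that] trunc_apply)
  qed
  then have "{madden_rep e (g n) {..<real n} | n. n \<ge> 1} = h ` ?\<U>" by auto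
  moreover have "kJoin e (h ` ?\<U>) = h (\<Union>?\<U>)" by (rule RL_Union[OF h, symmetric]) auto
  moreover have "\<Union>?\<U> = UNIV"
  proof -
    have "x \<in> \<Union>?\<U>" for x :: real
    proof -
      obtain n where "x < real n" using reals_Archimedean2 by blast
      \<comment> \<open>The bound \<open>n\<close> may be zero, while the cover is indexed from
        one.\<close>
      then show ?thesis by (auto intro!: bexI[of _ "n + 1"])
    qed
    then show ?thesis by blast
  qed
  ultimately show ?thesis by (simp only: RL_UNIV[OF h])
qed

lemma inf_nmult_of_truncates:
  assumes step: "\<And>n. n \<ge> 1 \<Longrightarrow> inf (g (n + 1)) (nmult n e) = g n" and m: "1 \<le> m" "m \<le> n"
  shows "inf (g n) (nmult m e) = g m"
  using m(2)
proof (induction n rule: dec_induct)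
  case base
  \<comment> \<open>The element \<open>g m\<close> is itself a meet with \<open>nmult m e\<close>,
    so meeting again changes nothing.\<close>
  then show ?case using step[OF m(1)] by (metis inf.idem inf.assoc)
next
  case (step n)
  obtain k where "n = m + k" using step.hyps le_Suc_ex by blast
  then have "nmult m e \<le> nmult n e" using unit_nonneg by (simp add: nmult_add nmult_nonneg)
  then have "inf (g (Suc n)) (nmult m e) = inf (inf (g (n + 1)) (nmult n e)) (nmult m e)"
    by (simp add: inf.assoc inf_absorb2)
  also have "\<dots> = g m" using step.IH assms(1)[of n] m(1) step.hyps by simp
  finally show ?case .
qed

text \<open>Below \<open>n\<close> all later truncates agree with the \<open>n\<close>-th one, so \<open>h\<close> is glued from the
  restrictions of the \<open>n\<close>-th truncate to \<open>{..<n}\<close>.\<close>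

lemma exists_truncated:
  assumes step: "\<And>n. n \<ge> 1 \<Longrightarrow> inf (g (n + 1)) (nmult n e) = g n"
    and cover: "kJoin e {madden_rep e (g n) {..<real n} | n. n \<ge> 1} = UNIV"
  shows "\<exists>h\<in>RL e. \<forall>n\<ge>1. madden_rep e (g n) = trunc (real n) h"
proof -
  define f where "f n = madden_rep e (g n)" for n
  define J where "J n = {..<real n}" for n
  define h where "h U = kJoin e {f n (U \<inter> J n) | n. n \<ge> 1}" for U
  have f: "f n \<in> RL e" for n unfolding f_def by (rule madden_rep_mem_RL)
  have J: "open (J n)" for n by (simp add: J_def)
  have cover': "kJoin e {f n (J n) | n. n \<ge> 1} = UNIV" using cover by (simp add: f_def J_def)
  have f_trunc: "f m U = f n ((\<lambda>x. min x (real m)) -` U)" if "1 \<le> m" "m \<le> n" "open U" for m n U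
    using madden_rep_inf_nmult[of "g n" m] that
    by (simp add: inf_nmult_of_truncates[where g = g, OF step] f_def trunc_apply)
  have f_le: "f m V = f n V" if "1 \<le> m" "m \<le> n" "open V" "V \<subseteq> J m" for m n V
  proof -
    \<comment> \<open>Truncation sends every point from \<open>real m\<close> upwards to
      \<open>real m\<close>; as this value is not in \<open>V\<close>, the preimage gains no
      points.\<close>
    have "real m \<notin> V" "\<And>x. x \<in> V \<Longrightarrow> x \<le> real m" using that(4) by (auto simp: J_def less_imp_le)
    then have "(\<lambda>x. min x (real m)) -` V = V" by (auto simp: min_def split: if_splits)
    then show ?thesis using f_trunc[OF that(1-3)] by simp
  qed
  have f_upper: "f n (U \<inter> J n) \<subseteq> h U" if "n \<ge> 1" for n U
    unfolding h_def by (rule kJoin_upper) (use that in auto)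
  have ker_h: "w_kernel e (h U)" for U unfolding h_def by (rule kernel_kJoin)
  have h_least: "h U \<subseteq> K" if "w_kernel e K" "\<And>n. n \<ge> 1 \<Longrightarrow> f n (U \<inter> J n) \<subseteq> K" for U K
    unfolding h_def kJoin_subset_iff[OF that(1)] using that(2) by auto
  have h_mono: "h U \<subseteq> h V" if "open U" "open V" "U \<subseteq> V" for U V
  proof (rule h_least[OF ker_h])
    fix n :: nat assume n: "n \<ge> 1"
    have "f n (U \<inter> J n) \<subseteq> f n (V \<inter> J n)" using that J by (intro RL_mono[OF f]) auto
    also have "\<dots> \<subseteq> h V" using n by (rule f_upper)
    finally show "f n (U \<inter> J n) \<subseteq> h V" .
  qed
  have h_Int: "h (U \<inter> V) = h U \<inter> h V" if UV: "open U" "open V" for U V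
  proof
    \<comment> \<open>Both pieces are read off from the truncate with the larger index
      \<open>m\<close>, which preserves intersections. The result lies below \<open>n\<close> and is
      carried back to index \<open>n\<close>.\<close>
    have aux: "f n (U \<inter> J n) \<inter> f m (V \<inter> J m) \<subseteq> h (U \<inter> V)"
      if UV: "open U" "open V" and mn: "1 \<le> n" "n \<le> m" for U V n m
    proof -
      have "f n (U \<inter> J n) = f m (U \<inter> J n)" using mn UV J by (intro f_le) auto
      then have "f n (U \<inter> J n) \<inter> f m (V \<inter> J m) = f m ((U \<inter> J n) \<inter> (V \<inter> J m))"
        using UV J by (simp add: RL_Int[OF f] open_Int)
      also have "(U \<inter> J n) \<inter> (V \<inter> J m) = U \<inter> V \<inter> J n" using mn by (auto simp: J_def)
      also have "f m (U \<inter> V \<inter> J n) = f n (U \<inter> V \<inter> J n)"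
        using mn UV J by (intro f_le[symmetric]) auto
      also have "\<dots> \<subseteq> h (U \<inter> V)" using mn(1) by (rule f_upper)
      finally show ?thesis .
    qed
    show "h U \<inter> h V \<subseteq> h (U \<inter> V)"
    proof (subst (1 2) h_def, rule kJoin_Int_kJoin_subset[OF ker_h], goal_cases)
      case (3 X Y)
      then obtain n m where nm: "n \<ge> 1" "m \<ge> 1" and X: "X = f n (U \<inter> J n)" and Y: "Y = f m (V \<inter> J m)"
        by auto
      show ?case
      proof (cases "n \<le> m")
        case True
        then show ?thesis unfolding X Y using UV nm by (intro aux)
      next
        case False
        then show ?thesis unfolding X Y using aux[of V U m n] UV nm by (simp add: Int_commute)
      qed
    qed (use UV J in \<open>auto intro: RL_kernel[OF f]\<close>)
  qed (use h_mono that in \<open>simp add: open_Int\<close>)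
  have h_Union: "h (\<Union>\<U>) = kJoin e (h ` \<U>)" if op: "\<And>U. U \<in> \<U> \<Longrightarrow> open U" for \<U>
  proof
    show "h (\<Union>\<U>) \<subseteq> kJoin e (h ` \<U>)"
    proof (rule h_least[OF kernel_kJoin])
      fix n :: nat assume n: "n \<ge> 1"
      have "\<Union>\<U> \<inter> J n = \<Union>((\<lambda>U. U \<inter> J n) ` \<U>)" by auto
      also have "f n \<dots> = kJoin e (f n ` (\<lambda>U. U \<inter> J n) ` \<U>)"
        using op J by (intro RL_Union[OF f]) auto
      also have "\<dots> \<subseteq> kJoin e (h ` \<U>)"
        unfolding kJoin_subset_iff[OF kernel_kJoin] ball_simps
        using f_upper[OF n] kJoin_upper[of _ "h ` \<U>"] by (meson image_eqI order_trans)
      finally show "f n (\<Union>\<U> \<inter> J n) \<subseteq> kJoin e (h ` \<U>)" .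
    qed
    show "kJoin e (h ` \<U>) \<subseteq> h (\<Union>\<U>)"
      unfolding kJoin_subset_iff[OF ker_h] ball_simps using op by (auto intro: h_mono[THEN subsetD])
  qed
  \<comment> \<open>Preservation of the top element is precisely property (2).\<close>
  have h: "restrict h {U. open U} \<in> RL e"
    by (intro RL_I ker_h h_Int h_Union) (use cover' in \<open>simp_all add: h_def\<close>)
  have "f n U = trunc (real n) (restrict h {U. open U}) U" if n: "n \<ge> 1" for n U
  proof (cases "open U")
    case U: True
    let ?T = "(\<lambda>x. min x (real n)) -` U"
    have T: "open ?T" using U by (rule open_min_vimage)
    have low: "U \<inter> J m = ?T \<inter> J m" if "m < n" for m
      using that by (force simp: J_def min_def)
    have "h ?T \<subseteq> f n U"
    proof (rule h_least[OF RL_kernel[OF f U]])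
      fix m :: nat assume m: "m \<ge> 1"
      show "f m (?T \<inter> J m) \<subseteq> f n U"
      proof (cases "n \<le> m")
        case True
        have "f m (?T \<inter> J m) \<subseteq> f m ?T" using T J by (intro RL_mono[OF f]) auto
        then show ?thesis using f_trunc[OF n True U] by simp
      next
        case False
        then have "f m (?T \<inter> J m) = f n (U \<inter> J m)"
          using m T J low[of m] f_le[of m n "?T \<inter> J m"] by (simp add: open_Int)
        also have "\<dots> \<subseteq> f n U" using U J by (intro RL_mono[OF f]) auto
        finally show ?thesis .
      qed
    qed
    moreover have "f n U \<subseteq> h ?T"
    \<comment> \<open>By property (2) the inclusion may be tested on each \<open>f m (J m)\<close>,
      where \<open>f n U\<close> becomes one of the kernels whose join is
      \<open>h ?T\<close>.\<close>
    proof (rule kernel_subset_of_cover[OF ker_h _ RL_kernel[OF f U] cover'])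
      fix X assume "X \<in> {f n (J n) | n. n \<ge> 1}"
      then obtain m where m: "m \<ge> 1" and X: "X = f m (J m)" by auto
      show "w_kernel e X" unfolding X using J by (rule RL_kernel[OF f])
      have "X \<inter> f n U = f m (?T \<inter> J m)"
      proof (cases "n \<le> m")
        case True
        then show ?thesis unfolding X f_trunc[OF n True U]
          using T J by (simp add: RL_Int[OF f] Int_commute)
      next
        case False
        then have "f m (J m) = f n (J m)" "f m (U \<inter> J m) = f n (U \<inter> J m)"
          using m U J f_le[of m n "J m"] f_le[of m n "U \<inter> J m"] by (simp_all add: open_Int)
        then show ?thesis unfolding X
          using False low[of m] RL_Int[OF f U J, of n m] by auto
      qed
      then show "X \<inter> f n U \<subseteq> h ?T" using f_upper[OF m] by simp
    qed
    ultimately show ?thesis using U T by (simp add: trunc_apply)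
  qed (simp add: RL_extensional[OF f] trunc_def)
  then have "f n = trunc (real n) (restrict h {U. open U})" if "n \<ge> 1" for n
    using that by blast
  with h show ?thesis unfolding f_def by blast
qed

end

theorem proposition5p2p2:
  fixes e :: "'a::lattice_ab_group_add" and g :: "nat \<Rightarrow> 'a"
  assumes "w_object (type_w e)"
  shows "(\<forall>h. h \<in> RL e \<and> RL_le (RL_const e 0) h \<and>
              (\<forall>n\<ge>1. 0 \<le> g n \<and> madden_rep e (g n) = RL_meet e h (RL_const e (real n))) \<longrightarrow>
            (\<forall>n\<ge>1. inf (g (n + 1)) (nmult n e) = g n) \<and>
            kJoin e {madden_rep e (g n) {..<real n} | n. n \<ge> 1} = UNIV)
       \<and> ((\<forall>n\<ge>1. inf (g (n + 1)) (nmult n e) = g n) \<and>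
          kJoin e {madden_rep e (g n) {..<real n} | n. n \<ge> 1} = UNIV \<longrightarrow>
            (\<exists>h\<in>RL e. \<forall>n\<ge>1. madden_rep e (g n) = RL_meet e h (RL_const e (real n))))"
proof -
  interpret madden e using assms by (rule madden.intro)
  show ?thesis
  proof (intro conjI allI impI)
    fix h assume h: "h \<in> RL e \<and> RL_le (RL_const e 0) h \<and>
      (\<forall>n\<ge>1. 0 \<le> g n \<and> madden_rep e (g n) = RL_meet e h (RL_const e (real n)))"
    then have RL: "h \<in> RL e" by (rule conjunct1)
    then have trunc: "madden_rep e (g n) = trunc (real n) h" if "n \<ge> 1" for n
      using h that by (simp add: RL_meet_const)
    show "inf (g (n + 1)) (nmult n e) = g n" if "n \<ge> 1" for n
      using trunc that by (rule truncates_inf)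
    show "kJoin e {madden_rep e (g n) {..<real n} | n. n \<ge> 1} = UNIV"
      using RL trunc by (rule truncates_cover)
  next
    assume *: "(\<forall>n\<ge>1. inf (g (n + 1)) (nmult n e) = g n) \<and>
      kJoin e {madden_rep e (g n) {..<real n} | n. n \<ge> 1} = UNIV"
    then obtain h where "h \<in> RL e" "\<forall>n\<ge>1. madden_rep e (g n) = trunc (real n) h"
      using exists_truncated[of g] by meson
    then show "\<exists>h\<in>RL e. \<forall>n\<ge>1. madden_rep e (g n) = RL_meet e h (RL_const e (real n))"
      by (intro bexI[of _ h]) (simp_all add: RL_meet_const)
  qed
qed

end
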